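(* Let $n$ be a prime and $C_n=\langle h\rangle$ cyclic of order $n$. Let $E_\alpha$ be the bicrossed product of $k[C_n]$ and the Radford algebra $R$ with parameter $\alpha\in k$, where $\alpha=0$ is the only possible parameter if $n\ne p$ and every $\alpha\in k$ is allowed if $n=p$. Up to interchanging the two factors: (1) If $n\neq p$, then $\alpha=0$ and the unique nontrivial exact factorization of $E_0$ is $E_0=R\cdot k[C_n]$. (2) If $n=p$, then for every $\alpha\in k$ the nontrivial exact factorizations of $E_\alpha$ are $$E_\alpha=R\cdot k[\langle hg^c\rangle],\qquad c\in\mathbb F_p.$$ In both cases $R=\mathfrak A^3_{C_p}(g,f)$ with $C_p=\langle g\rangle$ and $f(g^j)=j$, viewed as the Hopf subalgebra generated by $g$ and $x$.
   Context: $k$ is an algebraically closed field of characteristic $p>0$. For a positive integer $n$ and $\alpha\in k$ (with $\alpha=0$ if $p\nmid n$), $E_\alpha$ is the Hopf algebra generated as an algebra by $g,h,x$ with relations $g^p=1$, $h^n=1$, $gh=hg$, $x^p=x$, $gx-xg=g(1-g)$, $xh-hx=\alpha h(1-g)$, and $\Delta(g)=g\otimes g$, $\Delta(h)=h\otimes h$, $\Delta(x)=x\otimes1+g\otimes x$. It has basis $\{h^ig^jx^l\mid 0\le i<n,\ 0\le j,l<p\}$, and is the bicrossed product of $k[C_n]$, $C_n=\langle h\rangle$, and the Radford algebra $R$ for the matched pair with trivial left action, $g\triangleleft h=g$, $x\triangleleft h=x+\alpha(1-g)$. These are all the matched pairs between $k[C_n]$ and $R$. The Radford algebra $R=\mathfrak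 A^3_{C_p}(g,f)$ is the Hopf algebra generated by $g,x$ with relations $g^p=1$, $x^p=x$, $gx-xg=g(1-g)$ and $\Delta(g)=g\otimes g$, $\Delta(x)=x\otimes1+g\otimes x$. For Hopf subalgebras $B,T$ of a Hopf algebra $E$, $E=BT$ is an exact factorization if multiplication $B\otimes T\to E$ is bijective; it is nontrivial if $B$ and $T$ are both proper Hopf subalgebras. *)

theory Defs
  imports
    "HOL-Library.Poly_Mapping"
    "HOL-Computational_Algebra.Computational_Algebra"
begin

section \<open>Formal linear combinations and free algebras\<close>

text \<open>
  The vector space with basis \<open>'a\<close> is the type \<^typ>\<open>'a \<Rightarrow>\<^sub>0 'k\<close>, with the following scalar
  multiplication.
\<close>

definition fscale :: "'k::field \<Rightarrow> ('a \<Rightarrow>\<^sub>0 'k) \<Rightarrow> ('a \<Rightarrow>\<^sub>0 'k)" where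
  "fscale c t = Poly_Mapping.map ((*) c) t"

lemma lookup_fscale [simp]:
  "Poly_Mapping.lookup (fscale c t) a = c * Poly_Mapping.lookup t a"
  by (simp add: fscale_def Poly_Mapping.map.rep_eq when_def)

global_interpretation formal: vector_space "fscale :: 'k::field \<Rightarrow> ('a \<Rightarrow>\<^sub>0 'k) \<Rightarrow> ('a \<Rightarrow>\<^sub>0 'k)"
  by unfold_locales (auto intro!: poly_mapping_eqI simp: lookup_add algebra_simps)

text \<open>
  The linear extension of \<open>f\<close> from the basis \<open>'a\<close>, the target having scalar multiplication \<open>s\<close>.
\<close>

definition lin_ext :: "('k::field \<Rightarrow> 'b::comm_monoid_add \<Rightarrow> 'b) \<Rightarrow> ('a \<Rightarrow> 'b) \<Rightarrow> ('a \<Rightarrow>\<^sub>0 'k) \<Rightarrow> 'b" where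
  "lin_ext s f t = (\<Sum>a\<in>Poly_Mapping.keys t. s (Poly_Mapping.lookup t a) (f a))"

text \<open>
  The free monoid is written additively because the product of \<^typ>\<open>'m \<Rightarrow>\<^sub>0 'k\<close> is the convolution
  for an additive monoid \<open>'m\<close>.  Thus \<^typ>\<open>'x \<Rightarrow>\<^sub>0 'k\<close> is a free vector space, whereas
  \<open>'x free_word \<Rightarrow>\<^sub>0 'k\<close> is the free associative unital algebra on \<open>'x\<close>.
\<close>

datatype 'x free_word = Word (letters: "'x list")

instantiation free_word :: (type) monoid_add
begin

definition zero_free_word :: "'a free_word" where
  "0 = Word []"

definition plus_free_word :: "'a free_word \<Rightarrow> 'a free_word \<Rightarrow> 'a free_word" where
  "v + w = Word (letters v @ letters w)"

instance
  by standard (simp_all add: zero_free_word_def plus_free_word_def)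

end

definition gen :: "'x \<Rightarrow> ('x free_word \<Rightarrow>\<^sub>0 'k::field)" where
  "gen i = Poly_Mapping.single (Word [i]) 1"

definition two_sided_ideal ::
    "('x free_word \<Rightarrow>\<^sub>0 'k::field) set \<Rightarrow> ('x free_word \<Rightarrow>\<^sub>0 'k) set" where
  "two_sided_ideal Rel = formal.span {u * r * v |u r v. r \<in> Rel}"


section \<open>Tensor products\<close>

text \<open>
  \<open>V \<otimes> W\<close> is constructed as the quotient of the formal linear combinations of pairs in \<open>V \<times> W\<close>
  by the subspace generated by the bilinearity relations.  Here \<open>V\<close> and \<open>W\<close> are subspaces of the
  vector space with scalar multiplication \<open>s\<close>.
\<close>

definition pure :: "'a \<Rightarrow> 'b \<Rightarrow> ('a \<times> 'b \<Rightarrow>\<^sub>0 'k::field)" where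
  "pure a b = Poly_Mapping.single (a, b) 1"

definition pure3 :: "'a \<Rightarrow> 'b \<Rightarrow> 'c \<Rightarrow> ('a \<times> 'b \<times> 'c \<Rightarrow>\<^sub>0 'k::field)" where
  "pure3 a b c = Poly_Mapping.single (a, b, c) 1"

text \<open>The elements that have to vanish in order that \<open>\<tau>\<close> become linear on \<open>V\<close>.\<close>

definition linearity_relators ::
    "('k::field \<Rightarrow> 'e::ab_group_add \<Rightarrow> 'e) \<Rightarrow> 'e set \<Rightarrow> ('e \<Rightarrow> ('z \<Rightarrow>\<^sub>0 'k)) \<Rightarrow> ('z \<Rightarrow>\<^sub>0 'k) set" where
  "linearity_relators s V \<tau> =
     {\<tau> (a + a') - \<tau> a - \<tau> a' |a a'. a \<in> V \<and> a' \<in> V} \<union>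
     {\<tau> (s c a) - fscale c (\<tau> a) |c a. a \<in> V}"

definition tensor_null ::
    "('k::field \<Rightarrow> 'e::ab_group_add \<Rightarrow> 'e) \<Rightarrow> 'e set \<Rightarrow> 'e set \<Rightarrow> ('e \<times> 'e \<Rightarrow>\<^sub>0 'k) set" where
  "tensor_null s V W = formal.span
     ((\<Union>b\<in>W. linearity_relators s V (\<lambda>a. pure a b)) \<union>
      (\<Union>a\<in>V. linearity_relators s W (\<lambda>b. pure a b)))"

definition tensor_null3 ::
    "('k::field \<Rightarrow> 'e::ab_group_add \<Rightarrow> 'e) \<Rightarrow> ('e \<times> 'e \<times> 'e \<Rightarrow>\<^sub>0 'k) set" where
  "tensor_null3 s = formal.span
     ((\<Union>b c. linearity_relators s UNIV (\<lambda>a. pure3 a b c)) \<union>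
      (\<Union>a c. linearity_relators s UNIV (\<lambda>b. pure3 a b c)) \<union>
      (\<Union>a b. linearity_relators s UNIV (\<lambda>c. pure3 a b c)))"

definition formal_tensors :: "'e set \<Rightarrow> 'e set \<Rightarrow> ('e \<times> 'e \<Rightarrow>\<^sub>0 'k::field) set" where
  "formal_tensors V W = {t. Poly_Mapping.keys t \<subseteq> V \<times> W}"

definition tensor_product ::
    "('k::field \<Rightarrow> 'e::ab_group_add \<Rightarrow> 'e) \<Rightarrow> 'e set \<Rightarrow> 'e set \<Rightarrow> ('e \<times> 'e \<Rightarrow>\<^sub>0 'k) set set" where
  "tensor_product s V W = formal_tensors V W //
     {(t, t'). t \<in> formal_tensors V W \<and> t' \<in> formal_tensors V W \<and> t - t' \<in> tensor_null s V W}"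

definition tensor_mult ::
    "('e::ring_1 \<times> 'e \<Rightarrow>\<^sub>0 'k::field) \<Rightarrow> ('e \<times> 'e \<Rightarrow>\<^sub>0 'k) \<Rightarrow> ('e \<times> 'e \<Rightarrow>\<^sub>0 'k)" where
  "tensor_mult t t' =
     lin_ext fscale (\<lambda>(a, b). lin_ext fscale (\<lambda>(c, d). pure (a * c) (b * d)) t') t"


section \<open>Hopf algebras\<close>

text \<open>
  The ring structure is that of the type \<open>'e\<close>.  The field \<open>comult\<close> selects for each element a formal
  representative of its coproduct in the tensor square; only its class modulo \<^const>\<open>tensor_null\<close>
  is meaningful, and coproducts are compared by \<open>tensor_eq\<close>.
\<close>

record (overloaded) ('k, 'e) hopf =
  scl :: "'k \<Rightarrow> 'e \<Rightarrow> 'e"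
  comult :: "'e \<Rightarrow> ('e \<times> 'e \<Rightarrow>\<^sub>0 'k)"
  counit :: "'e \<Rightarrow> 'k"
  antipode :: "'e \<Rightarrow> 'e"

definition tensor_eq ::
    "('k::field, 'e::ring_1) hopf \<Rightarrow> ('e \<times> 'e \<Rightarrow>\<^sub>0 'k) \<Rightarrow> ('e \<times> 'e \<Rightarrow>\<^sub>0 'k) \<Rightarrow> bool" where
  "tensor_eq E t t' \<longleftrightarrow> t - t' \<in> tensor_null (scl E) UNIV UNIV"

locale hopf_algebra =
  fixes E :: "('k::field, 'e::ring_1) hopf" (structure)
  assumes vector_space: "vector_space (scl E)"
    and scl_mult_left: "scl E c a * b = scl E c (a * b)"
    and scl_mult_right: "a * scl E c b = scl E c (a * b)"
    and comult_add: "tensor_eq E (comult E (a + b)) (comult E a + comult E b)"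
    and comult_scl: "tensor_eq E (comult E (scl E c a)) (fscale c (comult E a))"
    and coassoc:
      "lin_ext fscale (\<lambda>(b, c). lin_ext fscale (\<lambda>(b1, b2). pure3 b1 b2 c) (comult E b)) (comult E a)
       - lin_ext fscale (\<lambda>(b, c). lin_ext fscale (\<lambda>(c1, c2). pure3 b c1 c2) (comult E c)) (comult E a)
       \<in> tensor_null3 (scl E)"
    and counit_linear: "Vector_Spaces.linear (scl E) (*) (counit E)"
    and counit_left: "lin_ext (scl E) (\<lambda>(b, c). scl E (counit E b) c) (comult E a) = a"
    and counit_right: "lin_ext (scl E) (\<lambda>(b, c). scl E (counit E c) b) (comult E a) = a"
    and comult_mult: "tensor_eq E (comult E (a * b)) (tensor_mult (comult E a) (comult E b))"
    and comult_one: "tensor_eq E (comult E 1) (pure 1 1)"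
    and counit_mult: "counit E (a * b) = counit E a * counit E b"
    and counit_one: "counit E 1 = 1"
    and antipode_linear: "Vector_Spaces.linear (scl E) (scl E) (antipode E)"
    and antipode_left: "lin_ext (scl E) (\<lambda>(b, c). antipode E b * c) (comult E a) = scl E (counit E a) 1"
    and antipode_right: "lin_ext (scl E) (\<lambda>(b, c). b * antipode E c) (comult E a) = scl E (counit E a) 1"

definition hopf_subalgebra :: "('k::field, 'e::ring_1) hopf \<Rightarrow> 'e set \<Rightarrow> bool" where
  "hopf_subalgebra E B \<longleftrightarrow>
     module.subspace (scl E) B \<and> 1 \<in> B \<and> (\<forall>a\<in>B. \<forall>b\<in>B. a * b \<in> B) \<and>
     (\<forall>b\<in>B. \<exists>t\<in>formal_tensors B B. tensor_eq E (comult E b) t) \<and>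
     (\<forall>b\<in>B. antipode E b \<in> B)"

definition hopf_subalgebra_generated :: "('k::field, 'e::ring_1) hopf \<Rightarrow> 'e set \<Rightarrow> 'e set" where
  "hopf_subalgebra_generated E A = \<Inter>{B. hopf_subalgebra E B \<and> A \<subseteq> B}"

text \<open>
  Multiplication as a map on \<^const>\<open>tensor_product\<close>: by distributivity it is constant on each class.
\<close>

definition mult_map :: "('k::field, 'e::ring_1) hopf \<Rightarrow> ('e \<times> 'e \<Rightarrow>\<^sub>0 'k) set \<Rightarrow> 'e" where
  "mult_map E C = the_elem (lin_ext (scl E) (\<lambda>(b, t). b * t) ` C)"

definition exact_factorization :: "('k::field, 'e::ring_1) hopf \<Rightarrow> 'e set \<Rightarrow> 'e set \<Rightarrow> bool" where
  "exact_factorization E B T \<longleftrightarrow>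
     hopf_subalgebra E B \<and> hopf_subalgebra E T \<and>
     bij_betw (mult_map E) (tensor_product (scl E) B T) UNIV"

definition nontrivial_exact_factorization ::
    "('k::field, 'e::ring_1) hopf \<Rightarrow> 'e set \<Rightarrow> 'e set \<Rightarrow> bool" where
  "nontrivial_exact_factorization E B T \<longleftrightarrow>
     exact_factorization E B T \<and> B \<noteq> UNIV \<and> T \<noteq> UNIV"

text \<open>
  \<open>k[\<langle>u\<rangle>]\<close> inside \<open>E\<close>, for \<open>u\<close> of finite multiplicative order (so that the natural powers of \<open>u\<close>
  already form the group \<open>\<langle>u\<rangle>\<close>).
\<close>

definition cyclic_group_algebra :: "('k::field, 'e::ring_1) hopf \<Rightarrow> 'e \<Rightarrow> 'e set" where
  "cyclic_group_algebra E u = module.span (scl E) {u ^ i |i::nat. True}"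


section \<open>Presentations; the Radford algebra and the Hopf algebras \<open>E\<^sub>\<alpha>\<close>\<close>

definition eval_free ::
    "('k::field, 'e::ring_1) hopf \<Rightarrow> ('x \<Rightarrow> 'e) \<Rightarrow> ('x free_word \<Rightarrow>\<^sub>0 'k) \<Rightarrow> 'e" where
  "eval_free E \<phi> = lin_ext (scl E) (\<lambda>w. prod_list (map \<phi> (letters w)))"

text \<open>
  The subalgebra \<open>B\<close> is the algebra generated by the elements \<open>\<phi> i\<close> with defining relations
  \<open>r = 0\<close>, \<open>r \<in> Rel\<close>: evaluation induces an isomorphism from the quotient of the free algebra by
  the ideal of the relations onto \<open>B\<close>.
\<close>

definition presented_by ::
    "('k::field, 'e::ring_1) hopf \<Rightarrow> 'e set \<Rightarrow> ('x \<Rightarrow> 'e) \<Rightarrow> ('x free_word \<Rightarrow>\<^sub>0 'k) set \<Rightarrow> bool" where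
  "presented_by E B \<phi> Rel \<longleftrightarrow>
     range (eval_free E \<phi>) = B \<and> {t. eval_free E \<phi> t = 0} = two_sided_ideal Rel"

datatype radford_gen = Rg | Rx

fun radford_assign :: "'e \<Rightarrow> 'e \<Rightarrow> radford_gen \<Rightarrow> 'e" where
  "radford_assign g x Rg = g"
| "radford_assign g x Rx = x"

definition radford_relators :: "(radford_gen free_word \<Rightarrow>\<^sub>0 'k::field) set" where
  "radford_relators =
     (let p = CHAR('k); g = gen Rg; x = gen Rx
      in {g ^ p - 1, x ^ p - x, (g * x - x * g) - g * (1 - g)})"

definition is_radford_algebra ::
    "('k::field, 'e::ring_1) hopf \<Rightarrow> 'e set \<Rightarrow> 'e \<Rightarrow> 'e \<Rightarrow> bool" where
  "is_radford_algebra E R g x \<longleftrightarrow>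
     hopf_subalgebra E R \<and> presented_by E R (radford_assign g x) radford_relators \<and>
     tensor_eq E (comult E g) (pure g g) \<and>
     tensor_eq E (comult E x) (pure x 1 + pure g x)"

datatype E_gen = Eg | Eh | Ex

fun E_assign :: "'e \<Rightarrow> 'e \<Rightarrow> 'e \<Rightarrow> E_gen \<Rightarrow> 'e" where
  "E_assign g h x Eg = g"
| "E_assign g h x Eh = h"
| "E_assign g h x Ex = x"

definition E_relators :: "nat \<Rightarrow> 'k::field \<Rightarrow> (E_gen free_word \<Rightarrow>\<^sub>0 'k) set" where
  "E_relators n \<alpha> =
     (let p = CHAR('k); g = gen Eg; h = gen Eh; x = gen Ex
      in {g ^ p - 1, h ^ n - 1, g * h - h * g, x ^ p - x,
          (g * x - x * g) - g * (1 - g),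
          (x * h - h * x) - fscale \<alpha> (h * (1 - g))})"

text \<open>
  Counit and antipode need not be prescribed on the generators, being determined by the
  comultiplication.
\<close>

locale E_alpha = hopf_algebra E
  for E :: "('k::field, 'e::ring_1) hopf" (structure)
  + fixes n :: nat and \<alpha> :: 'k and g h x :: 'e
  assumes n_pos: "n > 0"
    and parameter: "\<not> CHAR('k) dvd n \<Longrightarrow> \<alpha> = 0"
    and presentation: "presented_by E UNIV (E_assign g h x) (E_relators n \<alpha>)"
    and comult_g: "tensor_eq E (comult E g) (pure g g)"
    and comult_h: "tensor_eq E (comult E h) (pure h h)"
    and comult_x: "tensor_eq E (comult E x) (pure x 1 + pure g x)"

end

theory Submission
  imports Defs "HOL-Number_Theory.Cong"
begin

text \<open>
  Let \<open>G\<close> be the group generated by \<open>g\<close> and \<open>h\<close>; it is abelian of order \<open>np\<close>.  The Hopf algebra \<open>E\<close>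
  is pointed with coradical \<open>kG\<close>, and up to translation by \<open>G\<close>, scalars and summands in \<open>kG\<close> the only
  skew primitive element outside \<open>kG\<close> is \<open>x\<close>.  Hence a Hopf subalgebra \<open>B\<close> is either the group algebra of a subgroup of \<open>G\<close>,
  or it contains \<open>x\<close> and therefore \<open>R\<close> (\<open>hopf_subalgebra_cases\<close>).  As \<open>R\<close> has prime index \<open>n\<close>, in the
  second case \<open>B = R\<close> or \<open>B = E\<close> (\<open>hopf_subalgebra_containing_radford\<close>).  In a nontrivial exact
  factorization the two factors meet \<open>G\<close> in subgroups with trivial intersection, and they are not
  both contained in \<open>kG\<close>.  So one factor is \<open>R\<close>, and the other is the group algebra of a complement of
  \<open>\<langle>g\<rangle>\<close> in \<open>G\<close>, that is, of some \<open>\<langle>h g\<^sup>c\<rangle>\<close> with \<open>(h g\<^sup>c)\<^sup>n = 1\<close> (\<open>complement_cyclic\<close>); this condition says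
  \<open>c = 0\<close> or \<open>n = p\<close>.  Conversely \<open>h\<close> normalizes \<open>R\<close>, so in either order the products of basis
  elements of \<open>R\<close> and of \<open>k[\<langle>h g\<^sup>c\<rangle>]\<close> span \<open>E\<close>, and there are \<open>n p\<^sup>2 = dim E\<close> of them.

  Instead of the general theory of pointed coalgebras, the proof uses the actions
  \<open>a \<mapsto> f(a\<^sub>2) a\<^sub>1\<close> and \<open>a \<mapsto> f(a\<^sub>1) a\<^sub>2\<close> of linear functionals \<open>f\<close> on \<open>E\<close>, called slices below.  Every
  Hopf subalgebra is stable under them, and they can be computed because
  \<open>\<Delta>(u x\<^sup>l) = \<Sigma>\<^sub>m u A\<^sub>l\<^sub>m \<otimes> u x\<^sup>m\<close> for \<open>u \<in> G\<close>, where \<open>A\<^sub>l\<^sub>m\<close> is the sum of all words with \<open>m\<close> letters \<open>g\<close>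
  and \<open>l - m\<close> letters \<open>x\<close> (\<open>comult_grouplike_power\<close>).  Slicing an element of \<open>B\<close> by the coordinate of
  \<open>u x\<^sup>l\<^sup>-\<^sup>1\<close>, where \<open>u x\<^sup>l\<close> is its leading term at \<open>u\<close>, extracts the skew primitive element
  (\<open>leading_skew_primitive_mem\<close>).  The same slices show that the monomials \<open>u x\<^sup>l\<close> with \<open>l < p\<close> form a
  basis of \<open>E\<close> (\<open>indep_monomials_upto\<close>), once it is known that the \<open>np\<close> elements \<open>h\<^sup>ig\<^sup>j\<close> are distinct
  and that \<open>x\<close> lies outside \<open>kG\<close>.  For these two facts representations by triangular matrices of size
  two suffice.
\<close>

section \<open>Linear extensions and algebras over a field\<close>

lemma lin_ext_superset:
  assumes "module s" "finite A" "Poly_Mapping.keys t \<subseteq> A"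
  shows "lin_ext s f t = (\<Sum>a\<in>A. s (Poly_Mapping.lookup t a) (f a))"
  unfolding lin_ext_def
  by (rule sum.mono_neutral_left)
     (use assms in \<open>auto simp: in_keys_iff module.scale_zero_left\<close>)

lemma module_formal: "module (fscale :: 'k::field \<Rightarrow> ('a \<Rightarrow>\<^sub>0 'k) \<Rightarrow> _)"
  by (rule formal.module_axioms)

lemma lin_ext_hom:
  fixes s :: "'k::field \<Rightarrow> 'b::ab_group_add \<Rightarrow> 'b"
  assumes s: "module s"
  shows "module_hom fscale s (lin_ext s f)"
proof -
  interpret module s by fact
  have "lin_ext s f (t + t') = lin_ext s f t + lin_ext s f t'" for t t'
  proof -
    let ?A = "Poly_Mapping.keys t \<union> Poly_Mapping.keys t'"
    show ?thesis
      using Poly_Mapping.keys_add[of t t']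
      by (simp add: lin_ext_superset[OF s, of ?A] lookup_add scale_left_distrib sum.distrib)
  qed
  moreover have "lin_ext s f (fscale c t) = s c (lin_ext s f t)" for c t
  proof -
    have "Poly_Mapping.keys (fscale c t) \<subseteq> Poly_Mapping.keys t"
      by (auto simp: in_keys_iff)
    then show ?thesis
      by (simp add: lin_ext_superset[OF s, of "Poly_Mapping.keys t"] scale_sum_right)
  qed
  ultimately show ?thesis
    by (simp add: module_hom_iff s module_formal)
qed

lemma lin_ext_single:
  assumes "module s"
  shows "lin_ext s f (Poly_Mapping.single a c) = s c (f a)"
  by (simp add: lin_ext_superset[OF assms, of "{a}"])

lemma formal_eq_sum:
  "t = (\<Sum>a\<in>Poly_Mapping.keys t. fscale (Poly_Mapping.lookup t a) (Poly_Mapping.single a 1))"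
proof (rule poly_mapping_eqI)
  fix k
  have "(\<Sum>a\<in>Poly_Mapping.keys t. Poly_Mapping.lookup t a * (1 when a = k)) = Poly_Mapping.lookup t k"
  proof -
    have "(\<Sum>a\<in>Poly_Mapping.keys t. Poly_Mapping.lookup t a * (1 when a = k))
        = (\<Sum>a\<in>Poly_Mapping.keys t. if a = k then Poly_Mapping.lookup t a else 0)"
      by (intro sum.cong) (auto simp: when_def)
    then show ?thesis by (simp add: sum.delta' in_keys_iff)
  qed
  then show "Poly_Mapping.lookup t k = Poly_Mapping.lookup (\<Sum>a\<in>Poly_Mapping.keys t.
      fscale (Poly_Mapping.lookup t a) (Poly_Mapping.single a 1)) k"
    by (simp add: lookup_sum lookup_single)
qed

lemma module_hom_formal_eqI:
  assumes F: "module_hom fscale s F" and G: "module_hom fscale s G"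
    and eq: "\<And>a. a \<in> Poly_Mapping.keys t \<Longrightarrow>
               F (Poly_Mapping.single a 1) = G (Poly_Mapping.single a 1)"
  shows "F t = G t"
  by (subst (1 2) formal_eq_sum)
     (simp add: module_hom.sum[OF F] module_hom.sum[OF G] module_hom.scale[OF F]
        module_hom.scale[OF G] eq)

lemma formal_in_span_pure:
  "t \<in> formal.span {Poly_Mapping.single a (1::'k::field) |a. a \<in> Poly_Mapping.keys t}"
proof -
  have "(\<Sum>a\<in>Poly_Mapping.keys t. fscale (Poly_Mapping.lookup t a) (Poly_Mapping.single a 1))
     \<in> formal.span {Poly_Mapping.single a (1::'k) |a. a \<in> Poly_Mapping.keys t}"
    by (intro formal.span_sum formal.span_scale formal.span_base) auto
  then show ?thesis by (simp flip: formal_eq_sum)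
qed

locale k_algebra = vector_space s
  for s :: "'k::field \<Rightarrow> 'a::ring_1 \<Rightarrow> 'a" +
  assumes mult_scale_left: "s c a * b = s c (a * b)"
    and mult_scale_right: "a * s c b = s c (a * b)"
begin

lemma module_s: "module s" ..

lemma hom_mult_left: "module_hom s s (\<lambda>a. b * a)"
  by (simp add: module_hom_iff module_s distrib_left mult_scale_right)

lemma hom_mult_right: "module_hom s s (\<lambda>a. a * b)"
  by (simp add: module_hom_iff module_s distrib_right mult_scale_left)

lemma span_mult_left:
  assumes "\<And>b. b \<in> S \<Longrightarrow> a * b \<in> span S'" "b \<in> span S"
  shows "a * b \<in> span S'"
proof -
  have "subspace ((\<lambda>b. a * b) -` span S')"
    by (rule module_hom.subspace_vimage[OF hom_mult_left]) simp
  then show ?thesis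
    using span_minimal[of S "(\<lambda>b. a * b) -` span S'"] assms by auto
qed

lemma span_mult_right:
  assumes "\<And>b. b \<in> S \<Longrightarrow> b * a \<in> span S'" "b \<in> span S"
  shows "b * a \<in> span S'"
proof -
  have "subspace ((\<lambda>b. b * a) -` span S')"
    by (rule module_hom.subspace_vimage[OF hom_mult_right]) simp
  then show ?thesis
    using span_minimal[of S "(\<lambda>b. b * a) -` span S'"] assms by auto
qed

end

lemma k_algebra_free: "k_algebra (fscale :: 'k::field \<Rightarrow> ('m::monoid_add \<Rightarrow>\<^sub>0 'k) \<Rightarrow> _)"
proof
  have eq: "fscale c a = Poly_Mapping.single 0 c * a" for c and a :: "'m \<Rightarrow>\<^sub>0 'k"
    by (simp add: fscale_def mult_map_scale_conv_mult)
  fix c and a b :: "'m \<Rightarrow>\<^sub>0 'k"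
  show "fscale c a * b = fscale c (a * b)"
    by (simp add: eq mult.assoc)
  have hom: "module_hom fscale fscale (\<lambda>a. a * Poly_Mapping.single 0 c :: 'm \<Rightarrow>\<^sub>0 'k)"
    by (simp add: module_hom_iff module_formal distrib_right eq mult.assoc)
  have "a * Poly_Mapping.single 0 c = fscale c a" for a :: "'m \<Rightarrow>\<^sub>0 'k"
    by (rule module_hom_formal_eqI[OF hom, of "fscale c"])
       (simp_all only: module_hom_iff module_formal formal.scale_right_distrib formal.scale_left_commute
          simp_thms, simp add: eq mult_single mult.commute)
  then show "a * fscale c b = fscale c (a * b)"
    by (simp add: eq flip: mult.assoc)
qed

interpretation free: k_algebra "fscale :: 'k::field \<Rightarrow> ('m::monoid_add \<Rightarrow>\<^sub>0 'k) \<Rightarrow> _"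
  by (rule k_algebra_free)

section \<open>Evaluation of noncommutative polynomials\<close>

text \<open>
  The evaluation map depends on the scalar multiplication only; this form also covers target
  algebras that carry no Hopf structure.
\<close>

definition alg_eval :: "('k::field \<Rightarrow> 'a::ring_1 \<Rightarrow> 'a) \<Rightarrow> ('x \<Rightarrow> 'a) \<Rightarrow> ('x free_word \<Rightarrow>\<^sub>0 'k) \<Rightarrow> 'a"
  where "alg_eval s \<phi> = lin_ext s (\<lambda>w. prod_list (map \<phi> (letters w)))"

lemma eval_free_eq_alg_eval: "eval_free E \<phi> = alg_eval (scl E) \<phi>"
  by (simp add: eval_free_def alg_eval_def)

context k_algebra
begin

lemma alg_eval_hom: "module_hom fscale s (alg_eval s \<phi>)"
  unfolding alg_eval_def by (rule lin_ext_hom[OF module_s])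

lemmas alg_eval_add = module_hom.add[OF alg_eval_hom]
lemmas alg_eval_diff = module_hom.diff[OF alg_eval_hom]
lemmas alg_eval_zero = module_hom.zero[OF alg_eval_hom]
lemmas alg_eval_scale = module_hom.scale[OF alg_eval_hom]
lemmas alg_eval_sum = module_hom.sum[OF alg_eval_hom]

lemma alg_eval_word: "alg_eval s \<phi> (Poly_Mapping.single w 1) = prod_list (map \<phi> (letters w))"
  by (simp add: alg_eval_def lin_ext_single[OF module_s])

lemma alg_eval_gen: "alg_eval s \<phi> (gen i) = \<phi> i"
  by (simp add: gen_def alg_eval_word)

lemma alg_eval_one: "alg_eval s \<phi> 1 = 1"
  using alg_eval_word[of \<phi> 0] by (simp add: zero_free_word_def flip: single_one)

lemma alg_eval_mult: "alg_eval s \<phi> (t * t') = alg_eval s \<phi> t * alg_eval s \<phi> t'"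
proof (rule module_hom_formal_eqI[where t = t and s = s])
  show "module_hom fscale s (\<lambda>t. alg_eval s \<phi> (t * t'))"
    by (simp add: module_hom_iff module_s module_formal distrib_right alg_eval_add
        free.mult_scale_left alg_eval_scale)
  show "module_hom fscale s (\<lambda>t. alg_eval s \<phi> t * alg_eval s \<phi> t')"
    by (simp add: module_hom_iff module_s module_formal distrib_right alg_eval_add
        mult_scale_left alg_eval_scale)
next
  fix v
  show "alg_eval s \<phi> (Poly_Mapping.single v 1 * t') =
      alg_eval s \<phi> (Poly_Mapping.single v 1) * alg_eval s \<phi> t'"
  proof (rule module_hom_formal_eqI[where t = t' and s = s])
    show "module_hom fscale s (\<lambda>t. alg_eval s \<phi> (Poly_Mapping.single v 1 * t))"
      by (simp add: module_hom_iff module_s module_formal distrib_left alg_eval_add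
          free.mult_scale_right alg_eval_scale)
    show "module_hom fscale s (\<lambda>t. alg_eval s \<phi> (Poly_Mapping.single v 1) * alg_eval s \<phi> t)"
      by (simp add: module_hom_iff module_s module_formal distrib_left alg_eval_add
          mult_scale_right alg_eval_scale)
  qed (simp add: mult_single alg_eval_word plus_free_word_def)
qed

lemma alg_eval_power: "alg_eval s \<phi> (t ^ m) = alg_eval s \<phi> t ^ m"
  by (induction m) (simp_all add: alg_eval_one alg_eval_mult)

lemmas alg_eval_simps = alg_eval_add alg_eval_diff alg_eval_zero alg_eval_scale alg_eval_gen
  alg_eval_one alg_eval_mult alg_eval_power

lemma range_alg_eval_subset:
  assumes M: "subspace M" "1 \<in> M" and closed: "\<And>i a. a \<in> M \<Longrightarrow> \<phi> i * a \<in> M"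
  shows "range (alg_eval s \<phi>) \<subseteq> M"
proof -
  have "prod_list (map \<phi> w) \<in> M" for w
    by (induction w) (simp_all add: M closed)
  then show ?thesis
    by (auto simp: alg_eval_def lin_ext_def intro!: subspace_sum[OF M(1)] subspace_scale[OF M(1)])
qed

lemma alg_eval_mem:
  assumes M: "subspace M" "1 \<in> M" and closed: "\<And>i a. a \<in> M \<Longrightarrow> \<phi> i * a \<in> M"
  shows "alg_eval s \<phi> t \<in> M"
  using range_alg_eval_subset[of M \<phi>, OF M closed] by blast

lemma alg_eval_ideal_zero:
  assumes "\<And>r. r \<in> Rel \<Longrightarrow> alg_eval s \<phi> r = 0" and t: "t \<in> two_sided_ideal Rel"
  shows "alg_eval s \<phi> t = 0"
proof -
  have "formal.subspace {t. alg_eval s \<phi> t = 0}"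
    by (rule module_hom.subspace_kernel[OF alg_eval_hom])
  then show ?thesis
    using t formal.span_minimal[of "{u * r * v |u r v. r \<in> Rel}" "{t. alg_eval s \<phi> t = 0}"]
    unfolding two_sided_ideal_def by (force simp: alg_eval_mult assms(1))
qed

end

lemma subspace_two_sided_ideal: "formal.subspace (two_sided_ideal Rel)"
  by (simp add: two_sided_ideal_def)

lemma two_sided_ideal_base: "r \<in> Rel \<Longrightarrow> r \<in> two_sided_ideal Rel"
  unfolding two_sided_ideal_def by (rule formal.span_base) (metis (mono_tags, lifting) mem_Collect_eq mult_1_left mult_1_right)

lemma two_sided_ideal_mult_left:
  "t \<in> two_sided_ideal Rel \<Longrightarrow> a * t \<in> two_sided_ideal Rel"
  unfolding two_sided_ideal_def
proof (rule free.span_mult_left, rule formal.span_base)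
  fix b assume "b \<in> {u * r * v |u r v. r \<in> Rel}"
  then obtain u r v where "r \<in> Rel" and b: "b = u * r * v" by blast
  moreover have "a * b = (a * u) * r * v" by (simp add: b mult.assoc)
  ultimately show "a * b \<in> {u * r * v |u r v. r \<in> Rel}" by blast
qed

lemma two_sided_ideal_mult_right:
  "t \<in> two_sided_ideal Rel \<Longrightarrow> t * a \<in> two_sided_ideal Rel"
  unfolding two_sided_ideal_def
proof (rule free.span_mult_right, rule formal.span_base)
  fix b assume "b \<in> {u * r * v |u r v. r \<in> Rel}"
  then obtain u r v where "r \<in> Rel" and b: "b = u * r * v" by blast
  moreover have "b * a = u * r * (v * a)" by (simp add: b mult.assoc)
  ultimately show "b * a \<in> {u * r * v |u r v. r \<in> Rel}" by blast
qed

text \<open>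
  A family satisfying the defining relations of a presented algebra extends to a homomorphism.
\<close>

lemma presented_by_hom:
  fixes E :: "('k::field, 'e::ring_1) hopf" and s :: "'k \<Rightarrow> 'a::ring_1 \<Rightarrow> 'a"
  assumes E: "k_algebra (scl E)" and s: "k_algebra s"
    and pres: "presented_by E UNIV \<phi> Rel"
    and rel: "\<And>r. r \<in> Rel \<Longrightarrow> alg_eval s \<psi> r = 0"
  obtains \<rho> where "module_hom (scl E) s \<rho>" "\<And>a b. \<rho> (a * b) = \<rho> a * \<rho> b" "\<rho> 1 = 1"
    "\<And>i. \<rho> (\<phi> i) = \<psi> i"
proof -
  interpret E: k_algebra "scl E" by fact
  interpret s: k_algebra s by fact
  define pre where "pre a = (SOME t. alg_eval (scl E) \<phi> t = a)" for a
  have pre: "alg_eval (scl E) \<phi> (pre a) = a" for a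
  proof -
    have "\<exists>t. alg_eval (scl E) \<phi> t = a"
      using pres unfolding presented_by_def eval_free_eq_alg_eval by (metis UNIV_I imageE)
    then show ?thesis unfolding pre_def by (rule someI_ex)
  qed
  define \<rho> where "\<rho> a = alg_eval s \<psi> (pre a)" for a
  have ker: "alg_eval s \<psi> t = 0" if "alg_eval (scl E) \<phi> t = 0" for t
    using that pres
    by (intro s.alg_eval_ideal_zero[OF rel]) (auto simp: presented_by_def eval_free_eq_alg_eval)
  have \<rho>: "\<rho> (alg_eval (scl E) \<phi> t) = alg_eval s \<psi> t" for t
    using ker[of "pre (alg_eval (scl E) \<phi> t) - t"] unfolding \<rho>_def
    by (simp add: pre E.alg_eval_diff s.alg_eval_diff)
  show ?thesis
  proof (rule that)
    have "\<rho> (a + b) = \<rho> a + \<rho> b" for a b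
      using \<rho>[of "pre a + pre b"] by (simp add: E.alg_eval_add s.alg_eval_add pre \<rho>_def)
    moreover have "\<rho> (scl E c a) = s c (\<rho> a)" for c a
      using \<rho>[of "fscale c (pre a)"] by (simp add: E.alg_eval_scale s.alg_eval_scale pre \<rho>_def)
    ultimately show "module_hom (scl E) s \<rho>"
      by (simp add: module_hom_iff E.module_s s.module_s)
    show "\<rho> (a * b) = \<rho> a * \<rho> b" for a b
      using \<rho>[of "pre a * pre b"] by (simp add: E.alg_eval_mult s.alg_eval_mult pre \<rho>_def)
    show "\<rho> 1 = 1" using \<rho>[of 1] by (simp add: E.alg_eval_one s.alg_eval_one)
    show "\<rho> (\<phi> i) = \<psi> i" for i using \<rho>[of "gen i"] by (simp add: E.alg_eval_gen s.alg_eval_gen)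
  qed
qed

section \<open>Families of vectors\<close>

definition indep_family :: "('k::field \<Rightarrow> 'b::ab_group_add \<Rightarrow> 'b) \<Rightarrow> ('i \<Rightarrow> 'b) \<Rightarrow> 'i set \<Rightarrow> bool" where
  "indep_family s e K \<longleftrightarrow> (\<forall>c. (\<Sum>k\<in>K. s (c k) (e k)) = 0 \<longrightarrow> (\<forall>k\<in>K. c k = 0))"

context vector_space
begin

lemma module_scale: "module scale" ..

lemma independent_dual_functionals:
  assumes "independent S"
  obtains f where "\<And>v. module_hom scale (*) (f v)"
    and "\<And>v w. w \<in> S \<Longrightarrow> f v w = (if v = w then 1 else 0)"
proof
  have span_ext: "span (extend_basis S) = UNIV" and indep_ext: "independent (extend_basis S)"
    and sub: "S \<subseteq> extend_basis S"
    using assms by (auto simp: span_extend_basis independent_extend_basis extend_basis_superset)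
  show "module_hom scale (*) (\<lambda>a. representation (extend_basis S) a v)" for v
    by (simp add: module_hom_iff module_scale representation_add representation_scale indep_ext span_ext)
       (unfold_locales, auto simp: algebra_simps)
  show "representation (extend_basis S) w v = (if v = w then 1 else 0)" if "w \<in> S" for v w
    using representation_basis[OF indep_ext, of w] that sub by auto
qed

lemma indep_family_inj_on:
  assumes "indep_family scale e K" "finite K"
  shows "inj_on e K"
proof (rule inj_onI, rule ccontr)
  fix i j assume ij: "i \<in> K" "j \<in> K" "e i = e j" "i \<noteq> j"
  define c where "c k = (if k = i then 1 else if k = j then - 1 else (0::'a))" for k
  have "(\<Sum>k\<in>K. scale (c k) (e k)) = (\<Sum>k\<in>{i, j}. scale (c k) (e k))"
    by (rule sum.mono_neutral_right) (use assms ij in \<open>auto simp: c_def\<close>)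
  also have "\<dots> = 0" using ij by (simp add: c_def)
  finally have "c i = 0" using assms(1) ij(1) unfolding indep_family_def by blast
  then show False by (simp add: c_def)
qed

lemma indep_family_independent:
  assumes "indep_family scale e K" "finite K"
  shows "independent (e ` K)"
proof (rule independent_if_scalars_zero)
  fix c v assume 0: "(\<Sum>v\<in>e ` K. scale (c v) v) = 0" and v: "v \<in> e ` K"
  have "(\<Sum>k\<in>K. scale (c (e k)) (e k)) = 0"
    using 0 by (simp add: sum.reindex[OF indep_family_inj_on[OF assms]])
  then show "c v = 0"
    using assms(1)[unfolded indep_family_def, rule_format, of "\<lambda>k. c (e k)"] v by auto
qed (use assms in simp)

lemma independent_indep_family:
  assumes "independent (e ` K)" "inj_on e K" "finite K"
  shows "indep_family scale e K"
  unfolding indep_family_def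
proof (intro allI impI ballI)
  fix c k assume 0: "(\<Sum>k\<in>K. scale (c k) (e k)) = 0" and k: "k \<in> K"
  have "(\<Sum>v\<in>e ` K. scale (c (the_inv_into K e v)) v) = 0"
    using 0 assms(2) by (simp add: sum.reindex the_inv_into_f_f)
  then have "c (the_inv_into K e (e k)) = 0"
    using independentD[OF assms(1), of "e ` K" "\<lambda>v. c (the_inv_into K e v)" "e k"] assms(3) k by simp
  then show "c k = 0" using assms(2) k by (simp add: the_inv_into_f_f)
qed

lemma indep_family_dual_functionals:
  assumes "indep_family scale e K" "finite K"
  obtains f where "\<And>k. module_hom scale (*) (f k)"
    and "\<And>k k'. k \<in> K \<Longrightarrow> k' \<in> K \<Longrightarrow> f k (e k') = (if k = k' then 1 else 0)"
proof -
  obtain f where f: "\<And>v. module_hom scale (*) (f v)"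
    "\<And>v w. w \<in> e ` K \<Longrightarrow> f v w = (if v = w then 1 else 0)"
    using independent_dual_functionals[OF indep_family_independent[OF assms]] by metis
  show ?thesis
    by (rule that[of "\<lambda>k. f (e k)"])
       (use f inj_on_eq_iff[OF indep_family_inj_on[OF assms]] in auto)
qed

lemma indep_family_of_card:
  assumes S: "independent S" "finite S" "span S = UNIV"
    and e: "finite K" "span (e ` K) = UNIV" "card K = card S"
  shows "indep_family scale e K"
proof -
  obtain C where C: "C \<subseteq> e ` K" "independent C" "e ` K \<subseteq> span C"
    using maximal_independent_subset[of "e ` K"] by metis
  have "span C = UNIV" using C(3) e(2) span_mono[OF C(3)] by (simp add: span_span) blast
  then have "card S \<le> card C"
    using independent_span_bound[of C S] C(1) S(1) finite_subset[OF C(1)] e(1) by simp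
  moreover have "card C \<le> card (e ` K)" using C(1) e(1) by (simp add: card_mono)
  moreover have "card (e ` K) \<le> card K" using e(1) by (rule card_image_le)
  ultimately have eq: "card C = card (e ` K)" "card (e ` K) = card K" using e(3) by auto
  have "C = e ` K" using C(1) eq(1) e(1) by (simp add: card_subset_eq)
  then show ?thesis
    using independent_indep_family[of e K] C(2) eq(2) e(1) by (simp add: inj_on_iff_eq_card)
qed

lemma span_image_family:
  assumes "a \<in> span (e ` K)" "finite K"
  obtains c where "a = (\<Sum>k\<in>K. scale (c k) (e k))"
proof -
  have "span (e ` K) \<subseteq> {a. \<exists>c. a = (\<Sum>k\<in>K. scale (c k) (e k))}"
  proof (rule span_minimal)
    show "subspace {a. \<exists>c. a = (\<Sum>k\<in>K. scale (c k) (e k))}"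
    proof (rule subspaceI)
      show "0 \<in> {a. \<exists>c. a = (\<Sum>k\<in>K. scale (c k) (e k))}"
        by (auto intro!: exI[of _ "\<lambda>_. 0"])
      show "a + b \<in> {a. \<exists>c. a = (\<Sum>k\<in>K. scale (c k) (e k))}"
        if ab: "a \<in> {a. \<exists>c. a = (\<Sum>k\<in>K. scale (c k) (e k))}"
          "b \<in> {a. \<exists>c. a = (\<Sum>k\<in>K. scale (c k) (e k))}" for a b
      proof -
        obtain c d where "a = (\<Sum>k\<in>K. scale (c k) (e k))" "b = (\<Sum>k\<in>K. scale (d k) (e k))"
          using ab by blast
        then have "a + b = (\<Sum>k\<in>K. scale (c k + d k) (e k))"
          by (simp add: scale_left_distrib sum.distrib)
        then show ?thesis by (auto intro!: exI[of _ "\<lambda>k. c k + d k"])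
      qed
      show "scale r a \<in> {a. \<exists>c. a = (\<Sum>k\<in>K. scale (c k) (e k))}"
        if "a \<in> {a. \<exists>c. a = (\<Sum>k\<in>K. scale (c k) (e k))}" for r a
        using that by (auto simp: scale_sum_right intro: exI[of _ "\<lambda>k. r * _ k"])
    qed
    show "e ` K \<subseteq> {a. \<exists>c. a = (\<Sum>k\<in>K. scale (c k) (e k))}"
    proof clarify
      fix k assume "k \<in> K"
      then have "e k = (\<Sum>k'\<in>K. if k' = k then e k else 0)"
        using assms(2) by simp
      also have "\<dots> = (\<Sum>k'\<in>K. scale (if k' = k then 1 else 0) (e k'))"
        by (rule sum.cong) auto
      finally show "\<exists>c. e k = (\<Sum>k\<in>K. scale (c k) (e k))"
        by (rule exI[of _ "\<lambda>k'. if k' = k then 1 else 0"])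
    qed
  qed
  then show ?thesis using assms(1) that by blast
qed

end

section \<open>Bilinear maps and coproducts\<close>

definition bilinear_map ::
    "('k::field \<Rightarrow> 'e::ab_group_add \<Rightarrow> 'e) \<Rightarrow> ('k \<Rightarrow> 'b::ab_group_add \<Rightarrow> 'b) \<Rightarrow> ('e \<Rightarrow> 'e \<Rightarrow> 'b) \<Rightarrow> bool"
  where "bilinear_map s s' \<beta> \<longleftrightarrow>
    (\<forall>b. module_hom s s' (\<lambda>a. \<beta> a b)) \<and> (\<forall>a. module_hom s s' (\<beta> a))"

lemma lin_ext_pure:
  assumes "module s"
  shows "lin_ext s f (pure a b) = f (a, b)"
  by (simp add: pure_def lin_ext_single[OF assms] module.scale_one[OF assms])

lemma lin_ext_tensor_null:
  assumes \<beta>: "bilinear_map s s' \<beta>" and t: "t \<in> tensor_null s V W"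
  shows "lin_ext s' (\<lambda>(a, b). \<beta> a b) t = 0"
proof -
  have l: "module_hom s s' (\<lambda>a. \<beta> a b)" and r: "module_hom s s' (\<beta> a)" for a b
    using \<beta> by (simp_all add: bilinear_map_def)
  have s': "module s'" using r by (simp add: module_hom_iff)
  interpret ev: module_hom fscale s' "lin_ext s' (\<lambda>(a, b). \<beta> a b)"
    by (rule lin_ext_hom[OF s'])
  have "(\<Union>b\<in>W. linearity_relators s V (\<lambda>a. pure a b)) \<union>
        (\<Union>a\<in>V. linearity_relators s W (\<lambda>b. pure a b))
      \<subseteq> {t. lin_ext s' (\<lambda>(a, b). \<beta> a b) t = 0}"
    by (auto simp: linearity_relators_def ev.diff ev.scale lin_ext_pure[OF s']
        module_hom.add[OF l] module_hom.add[OF r] module_hom.scale[OF l] module_hom.scale[OF r])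
  from formal.span_minimal[OF this ev.subspace_kernel] show ?thesis
    using t unfolding tensor_null_def by auto
qed

lemma subspace_tensor_null: "formal.subspace (tensor_null s V W)"
  by (simp add: tensor_null_def)

lemma tensor_null_add_left:
  "a \<in> V \<Longrightarrow> a' \<in> V \<Longrightarrow> b \<in> W \<Longrightarrow> pure (a + a') b - (pure a b + pure a' b) \<in> tensor_null s V W"
  unfolding tensor_null_def
  by (rule formal.span_base) (auto simp: linearity_relators_def simp flip: diff_diff_eq)

lemma tensor_null_add_right:
  "a \<in> V \<Longrightarrow> b \<in> W \<Longrightarrow> b' \<in> W \<Longrightarrow> pure a (b + b') - (pure a b + pure a b') \<in> tensor_null s V W"
  unfolding tensor_null_def
  by (rule formal.span_base) (auto simp: linearity_relators_def simp flip: diff_diff_eq)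

lemma tensor_null_scale_left:
  "a \<in> V \<Longrightarrow> b \<in> W \<Longrightarrow> pure (s c a) b - fscale c (pure a b) \<in> tensor_null s V W"
  unfolding tensor_null_def
  by (rule formal.span_base) (auto simp: linearity_relators_def)

lemma tensor_null_scale_right:
  "a \<in> V \<Longrightarrow> b \<in> W \<Longrightarrow> pure a (s c b) - fscale c (pure a b) \<in> tensor_null s V W"
  unfolding tensor_null_def
  by (rule formal.span_base) (auto simp: linearity_relators_def)

lemma tensor_mult_hom_left: "module_hom fscale fscale (\<lambda>t. tensor_mult t t')"
  unfolding tensor_mult_def by (rule lin_ext_hom[OF module_formal])

lemma tensor_mult_hom_right: "module_hom fscale fscale (tensor_mult t)"
proof -
  define M :: "'b \<times> 'b \<Rightarrow> ('b \<times> 'b \<Rightarrow>\<^sub>0 'a) \<Rightarrow> ('b \<times> 'b \<Rightarrow>\<^sub>0 'a)"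
    where "M z = lin_ext fscale (\<lambda>(c, d). pure (fst z * c) (snd z * d))" for z
  have M: "module_hom fscale fscale (M z)" for z
    unfolding M_def by (rule lin_ext_hom[OF module_formal])
  have "tensor_mult t u = (\<Sum>z\<in>Poly_Mapping.keys t. fscale (Poly_Mapping.lookup t z) (M z u))" for u
    by (simp add: tensor_mult_def lin_ext_def[of _ _ t] M_def case_prod_beta)
  then show ?thesis
    by (simp add: module_hom_iff module_formal module_hom.add[OF M] module_hom.scale[OF M]
        formal.scale_right_distrib sum.distrib formal.scale_sum_right mult.commute)
qed

lemma tensor_mult_pure: "tensor_mult (pure a b) (pure c d) = pure (a * c) (b * d)"
  by (simp add: tensor_mult_def lin_ext_pure[OF module_formal])

lemma formal_induct_pure:
  assumes "formal.subspace S" "\<And>a b. (a, b) \<in> Poly_Mapping.keys t \<Longrightarrow> pure a b \<in> S"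
  shows "t \<in> S"
proof -
  have "{Poly_Mapping.single a 1 |a. a \<in> Poly_Mapping.keys t} \<subseteq> S"
    using assms(2) by (auto simp: pure_def)
  from formal.span_minimal[OF this assms(1)] formal_in_span_pure[of t] show ?thesis by auto
qed

context k_algebra
begin

lemma tensor_null_mult_right:
  assumes "t \<in> tensor_null s UNIV UNIV"
  shows "tensor_mult t t' \<in> tensor_null s UNIV UNIV"
proof -
  have "formal.subspace (tensor_mult t -` tensor_null s UNIV UNIV)"
    by (rule module_hom.subspace_vimage[OF tensor_mult_hom_right subspace_tensor_null])
  moreover have "tensor_mult t (pure c d) \<in> tensor_null s UNIV UNIV" for c d
  proof -
    have gens: "(\<Union>b\<in>UNIV. linearity_relators s UNIV (\<lambda>a. pure a b)) \<union>
        (\<Union>a\<in>UNIV. linearity_relators s UNIV (\<lambda>b. pure a b))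
      \<subseteq> (\<lambda>t. tensor_mult t (pure c d)) -` tensor_null s UNIV UNIV"
      using tensor_null_add_left[of _ UNIV _ _ UNIV s] tensor_null_add_right[of _ UNIV _ UNIV _ s]
        tensor_null_scale_left[of _ UNIV _ UNIV s] tensor_null_scale_right[of _ UNIV _ UNIV s]
      by (auto simp: linearity_relators_def module_hom.diff[OF tensor_mult_hom_left]
          module_hom.add[OF tensor_mult_hom_left] module_hom.scale[OF tensor_mult_hom_left] tensor_mult_pure distrib_right mult_scale_left
          diff_diff_eq)
    from formal.span_minimal[OF this
        module_hom.subspace_vimage[OF tensor_mult_hom_left subspace_tensor_null]] assms
    show ?thesis unfolding tensor_null_def by auto
  qed
  ultimately show ?thesis
    using formal_induct_pure[of "tensor_mult t -` tensor_null s UNIV UNIV" t'] by auto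
qed

lemma tensor_null_mult_left:
  assumes "t' \<in> tensor_null s UNIV UNIV"
  shows "tensor_mult t t' \<in> tensor_null s UNIV UNIV"
proof -
  have "formal.subspace ((\<lambda>t. tensor_mult t t') -` tensor_null s UNIV UNIV)"
    by (rule module_hom.subspace_vimage[OF tensor_mult_hom_left subspace_tensor_null])
  moreover have "tensor_mult (pure c d) t' \<in> tensor_null s UNIV UNIV" for c d
  proof -
    have gens: "(\<Union>b\<in>UNIV. linearity_relators s UNIV (\<lambda>a. pure a b)) \<union>
        (\<Union>a\<in>UNIV. linearity_relators s UNIV (\<lambda>b. pure a b))
      \<subseteq> tensor_mult (pure c d) -` tensor_null s UNIV UNIV"
      using tensor_null_add_left[of _ UNIV _ _ UNIV s] tensor_null_add_right[of _ UNIV _ UNIV _ s]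
        tensor_null_scale_left[of _ UNIV _ UNIV s] tensor_null_scale_right[of _ UNIV _ UNIV s]
      by (auto simp: linearity_relators_def module_hom.diff[OF tensor_mult_hom_right]
          module_hom.add[OF tensor_mult_hom_right] module_hom.scale[OF tensor_mult_hom_right] tensor_mult_pure distrib_left mult_scale_right
          diff_diff_eq)
    from formal.span_minimal[OF this
        module_hom.subspace_vimage[OF tensor_mult_hom_right subspace_tensor_null]] assms
    show ?thesis unfolding tensor_null_def by auto
  qed
  ultimately show ?thesis
    using formal_induct_pure[of "(\<lambda>t. tensor_mult t t') -` tensor_null s UNIV UNIV" t] by auto
qed

end

lemma tensor_eq_refl [simp]: "tensor_eq E t t"
  by (simp add: tensor_eq_def formal.subspace_0[OF subspace_tensor_null])

lemma tensor_eq_sym: "tensor_eq E t t' \<Longrightarrow> tensor_eq E t' t"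
  unfolding tensor_eq_def
  using formal.subspace_neg[OF subspace_tensor_null, of "t - t'" "scl E" UNIV UNIV] by simp

lemma tensor_eq_trans [trans]: "tensor_eq E t t' \<Longrightarrow> tensor_eq E t' t'' \<Longrightarrow> tensor_eq E t t''"
  unfolding tensor_eq_def
  using formal.subspace_add[OF subspace_tensor_null, of "t - t'" "scl E" UNIV UNIV "t' - t''"] by simp

lemma tensor_eq_add: "tensor_eq E t t' \<Longrightarrow> tensor_eq E u u' \<Longrightarrow> tensor_eq E (t + u) (t' + u')"
  unfolding tensor_eq_def
  using formal.subspace_add[OF subspace_tensor_null, of "t - t'" "scl E" UNIV UNIV "u - u'"]
  by (simp add: algebra_simps)

lemma tensor_eq_scale: "tensor_eq E t t' \<Longrightarrow> tensor_eq E (fscale c t) (fscale c t')"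
  unfolding tensor_eq_def
  using formal.subspace_scale[OF subspace_tensor_null, of "t - t'" "scl E" UNIV UNIV c]
  by (simp add: formal.scale_right_diff_distrib)

lemma tensor_eq_sum:
  "(\<And>i. i \<in> I \<Longrightarrow> tensor_eq E (t i) (t' i)) \<Longrightarrow> tensor_eq E (\<Sum>i\<in>I. t i) (\<Sum>i\<in>I. t' i)"
  by (induction I rule: infinite_finite_induct) (auto intro: tensor_eq_add)

lemma tensor_eq_pure_add_left: "tensor_eq E (pure (a + a') b) (pure a b + pure a' b)"
  by (simp add: tensor_eq_def tensor_null_add_left)

lemma tensor_eq_pure_zero_left: "module (scl E) \<Longrightarrow> tensor_eq E (pure 0 b) 0"
  using tensor_null_scale_left[of 0 UNIV b UNIV "scl E" 0]
  by (simp add: tensor_eq_def module.scale_zero_left)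

text \<open>
  For a bilinear \<open>\<beta>\<close> this is the sum of the \<open>\<beta>(a\<^sub>1, a\<^sub>2)\<close> in Sweedler notation.  With
  \<open>\<beta> a b = f(b) a\<close> or \<open>\<beta> a b = f(a) b\<close> it becomes the action of a functional \<open>f\<close> on \<open>E\<close>, under which
  every subcoalgebra is stable.
\<close>

definition sweedler :: "('k::field, 'e::ring_1) hopf \<Rightarrow> ('e \<Rightarrow> 'e \<Rightarrow> 'e) \<Rightarrow> 'e \<Rightarrow> 'e" where
  "sweedler E \<beta> a = lin_ext (scl E) (\<lambda>(b, c). \<beta> b c) (comult E a)"

definition grouplike :: "('k::field, 'e::ring_1) hopf \<Rightarrow> 'e \<Rightarrow> bool" where
  "grouplike E u \<longleftrightarrow> tensor_eq E (comult E u) (pure u u)"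

text \<open>
  The sum of all words of length \<open>l\<close> in \<open>g\<close> and \<open>x\<close> with exactly \<open>m\<close> letters \<open>g\<close>.
\<close>

fun word_sum :: "'e::ring_1 \<Rightarrow> 'e \<Rightarrow> nat \<Rightarrow> nat \<Rightarrow> 'e" where
  "word_sum g x l 0 = x ^ l"
| "word_sum g x 0 (Suc m) = 0"
| "word_sum g x (Suc l) (Suc m) = x * word_sum g x l (Suc m) + g * word_sum g x l m"

lemma word_sum_eq_0: "l < m \<Longrightarrow> word_sum g x l m = 0"
  by (induction g x l m rule: word_sum.induct) auto

lemma word_sum_diag: "word_sum g x l l = g ^ l"
  by (induction l) (simp_all add: word_sum_eq_0)

sublocale hopf_algebra \<subseteq> k_algebra "scl E"
  using vector_space scl_mult_left scl_mult_right
  by (auto simp: k_algebra_def k_algebra_axioms_def)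

context hopf_algebra
begin

lemma sweedler_eqI:
  assumes \<beta>: "bilinear_map (scl E) (scl E) \<beta>" and t: "tensor_eq E (comult E a) t"
  shows "sweedler E \<beta> a = lin_ext (scl E) (\<lambda>(b, c). \<beta> b c) t"
  using lin_ext_tensor_null[OF \<beta>, of "comult E a - t" UNIV UNIV] t
  by (simp add: tensor_eq_def sweedler_def module_hom.diff[OF lin_ext_hom[OF module_s]])

lemma sweedler_hom:
  assumes \<beta>: "bilinear_map (scl E) (scl E) \<beta>"
  shows "module_hom (scl E) (scl E) (sweedler E \<beta>)"
  by (simp add: module_hom_iff module_s sweedler_eqI[OF \<beta> comult_add] sweedler_eqI[OF \<beta> comult_scl]
      module_hom.add[OF lin_ext_hom[OF module_s]] module_hom.scale[OF lin_ext_hom[OF module_s]]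
      flip: sweedler_def)

lemma sweedler_mem:
  assumes B: "hopf_subalgebra E B" "b \<in> B"
    and \<beta>: "bilinear_map (scl E) (scl E) \<beta>" "\<And>a c. a \<in> B \<Longrightarrow> c \<in> B \<Longrightarrow> \<beta> a c \<in> B"
  shows "sweedler E \<beta> b \<in> B"
proof -
  obtain t where t: "t \<in> formal_tensors B B" "tensor_eq E (comult E b) t"
    using B unfolding hopf_subalgebra_def by blast
  have "subspace B" using B by (simp add: hopf_subalgebra_def)
  then show ?thesis
    using t \<beta>(2) unfolding sweedler_eqI[OF \<beta>(1) t(2)] lin_ext_def formal_tensors_def
    by (intro subspace_sum subspace_scale) auto
qed

lemma tensor_eq_mult:
  assumes "tensor_eq E t t'" "tensor_eq E u u'"
  shows "tensor_eq E (tensor_mult t u) (tensor_mult t' u')"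
proof -
  have "tensor_eq E (tensor_mult t u) (tensor_mult t' u)"
    using tensor_null_mult_right[of "t - t'" u] assms(1)
    by (simp add: tensor_eq_def module_hom.diff[OF tensor_mult_hom_left])
  also have "tensor_eq E (tensor_mult t' u) (tensor_mult t' u')"
    using tensor_null_mult_left[of "u - u'" t'] assms(2)
    by (simp add: tensor_eq_def module_hom.diff[OF tensor_mult_hom_right])
  finally show ?thesis .
qed

lemma comult_mult_eqI:
  assumes "tensor_eq E (comult E a) t" "tensor_eq E (comult E b) t'"
  shows "tensor_eq E (comult E (a * b)) (tensor_mult t t')"
  using tensor_eq_trans[OF comult_mult tensor_eq_mult[OF assms]] .

lemma grouplike_one: "grouplike E 1"
  by (simp add: grouplike_def comult_one)

lemma grouplike_mult: "grouplike E u \<Longrightarrow> grouplike E v \<Longrightarrow> grouplike E (u * v)"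
  unfolding grouplike_def by (drule (1) comult_mult_eqI) (simp add: tensor_mult_pure)

lemma grouplike_power: "grouplike E u \<Longrightarrow> grouplike E (u ^ m)"
  by (induction m) (simp_all add: grouplike_one grouplike_mult)

lemma sweedler_grouplike:
  assumes "bilinear_map (scl E) (scl E) \<beta>" "grouplike E u"
  shows "sweedler E \<beta> u = \<beta> u u"
  using sweedler_eqI[OF assms(1)] assms(2) by (simp add: grouplike_def lin_ext_pure[OF module_s])

text \<open>
  Expanding \<open>(x \<otimes> 1 + g \<otimes> x)\<^sup>l\<close>, the right tensor factors are powers of \<open>x\<close> only, since \<open>1\<close> and \<open>x\<close>
  commute; all the noncommutativity is in the left factors.
\<close>

lemma comult_power:
  assumes x: "tensor_eq E (comult E x) (pure x 1 + pure g x)"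
  shows "tensor_eq E (comult E (x ^ l)) (\<Sum>m\<le>l. pure (word_sum g x l m) (x ^ m))"
proof (induction l)
  case 0
  show ?case by (simp add: comult_one)
next
  case (Suc l)
  let ?A = "word_sum g x"
  have *: "tensor_eq E (\<Sum>m\<le>l. pure (x * ?A l m) (x ^ m))
      (pure (?A (Suc l) 0) 1 + (\<Sum>m\<le>l. pure (x * ?A l (Suc m)) (x ^ Suc m)))"
  proof -
    have "tensor_eq E ((\<Sum>m\<le>l. pure (x * ?A l m) (x ^ m)) + 0)
        ((\<Sum>m\<le>l. pure (x * ?A l m) (x ^ m)) + pure (x * ?A l (Suc l)) (x ^ Suc l))"
      by (intro tensor_eq_add tensor_eq_refl)
         (simp add: word_sum_eq_0 tensor_eq_sym tensor_eq_pure_zero_left module_s)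
    also have "\<dots> = (\<Sum>m\<le>Suc l. pure (x * ?A l m) (x ^ m))" by simp
    also have "\<dots> = pure (?A (Suc l) 0) 1 + (\<Sum>m\<le>l. pure (x * ?A l (Suc m)) (x ^ Suc m))"
      by (subst sum.atMost_Suc_shift) simp
    finally show ?thesis by simp
  qed
  have "tensor_eq E (comult E (x ^ Suc l))
     (tensor_mult (pure x 1 + pure g x) (\<Sum>m\<le>l. pure (?A l m) (x ^ m)))"
    using comult_mult_eqI[OF x Suc.IH] by simp
  also have "\<dots> = (\<Sum>m\<le>l. pure (x * ?A l m) (x ^ m)) + (\<Sum>m\<le>l. pure (g * ?A l m) (x ^ Suc m))"
    by (simp add: module_hom.add[OF tensor_mult_hom_left] module_hom.sum[OF tensor_mult_hom_right]
        tensor_mult_pure sum.distrib)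
  also have "tensor_eq E \<dots> ((pure (?A (Suc l) 0) 1 +
      (\<Sum>m\<le>l. pure (x * ?A l (Suc m)) (x ^ Suc m))) + (\<Sum>m\<le>l. pure (g * ?A l m) (x ^ Suc m)))"
    by (intro tensor_eq_add * tensor_eq_refl)
  also have "\<dots> = pure (?A (Suc l) 0) 1 +
      (\<Sum>m\<le>l. pure (x * ?A l (Suc m)) (x ^ Suc m) + pure (g * ?A l m) (x ^ Suc m))"
    by (simp add: sum.distrib add.assoc)
  also have "tensor_eq E \<dots> (pure (?A (Suc l) 0) 1 + (\<Sum>m\<le>l. pure (?A (Suc l) (Suc m)) (x ^ Suc m)))"
    by (intro tensor_eq_add tensor_eq_sum tensor_eq_refl)
       (simp add: tensor_eq_sym[OF tensor_eq_pure_add_left])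
  also have "\<dots> = (\<Sum>m\<le>Suc l. pure (?A (Suc l) m) (x ^ m))"
    by (subst sum.atMost_Suc_shift) simp
  finally show ?case .
qed

lemma comult_grouplike_power:
  assumes "grouplike E u" "tensor_eq E (comult E x) (pure x 1 + pure g x)"
  shows "tensor_eq E (comult E (u * x ^ l)) (\<Sum>m\<le>l. pure (u * word_sum g x l m) (u * x ^ m))"
  using comult_mult_eqI[OF assms(1)[unfolded grouplike_def] comult_power[OF assms(2), of l]]
  by (simp add: module_hom.sum[OF tensor_mult_hom_right] tensor_mult_pure)

lemma sweedler_grouplike_power:
  assumes \<beta>: "bilinear_map (scl E) (scl E) \<beta>"
    and "grouplike E u" "tensor_eq E (comult E x) (pure x 1 + pure g x)"
  shows "sweedler E \<beta> (u * x ^ l) = (\<Sum>m\<le>l. \<beta> (u * word_sum g x l m) (u * x ^ m))"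
  using sweedler_eqI[OF \<beta> comult_grouplike_power[OF assms(2,3)]]
  by (simp add: module_hom.sum[OF lin_ext_hom[OF module_s]] lin_ext_pure[OF module_s])

text \<open>
  In Sweedler notation, \<open>slice_right f a = f(a\<^sub>2) a\<^sub>1\<close> and \<open>slice_left f a = f(a\<^sub>1) a\<^sub>2\<close>.
\<close>

definition slice_right :: "('e \<Rightarrow> 'k) \<Rightarrow> 'e \<Rightarrow> 'e" where
  "slice_right f = sweedler E (\<lambda>a b. scl E (f b) a)"

definition slice_left :: "('e \<Rightarrow> 'k) \<Rightarrow> 'e \<Rightarrow> 'e" where
  "slice_left f = sweedler E (\<lambda>a b. scl E (f a) b)"

lemma bilinear_slice:
  assumes "module_hom (scl E) (*) f"
  shows "bilinear_map (scl E) (scl E) (\<lambda>a b. scl E (f b) a)"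
    and "bilinear_map (scl E) (scl E) (\<lambda>a b. scl E (f a) b)"
  using module_hom.add[OF assms] module_hom.scale[OF assms]
  by (auto simp: bilinear_map_def module_hom_iff module_s algebra_simps)

text \<open>
  If \<open>u = \<Sigma> c\<^sub>v v\<close> is a relation among grouplike elements with independent \<open>v\<close>, slicing it by the
  coordinate function of one \<open>v\<close> gives \<open>c\<^sub>v u\<close> when applied to \<open>u\<close>, and \<open>c\<^sub>v v\<close> when applied to the right
  hand side.
\<close>

lemma independent_grouplike:
  assumes "finite U" "\<And>u. u \<in> U \<Longrightarrow> grouplike E u" "0 \<notin> U"
  shows "independent U"
  using assms
proof (induction U)
  case empty
  show ?case by (rule independent_empty)
next
  case (insert u U)
  have indep: "independent U" using insert by auto
  have "u \<notin> span U"
  proof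
    assume u: "u \<in> span U"
    obtain f where f_hom: "module_hom (scl E) (*) (f v)"
      and f_U: "w \<in> U \<Longrightarrow> f v w = (if v = w then 1 else 0)" for v w
      using independent_dual_functionals[OF indep] by metis
    obtain c where c: "u = (\<Sum>v\<in>U. scl E (c v) v)"
      using u insert.hyps(1) by (auto simp: span_finite)
    have "c v = 0" if v: "v \<in> U" for v
    proof -
      interpret sl: module_hom "scl E" "scl E" "slice_right (f v)"
        unfolding slice_right_def by (rule sweedler_hom[OF bilinear_slice(1)[OF f_hom]])
      have f_u: "f v u = c v"
        using insert.hyps(1) v
        by (simp add: c module_hom.sum[OF f_hom] module_hom.scale[OF f_hom] f_U if_distrib[of "(*) _"]
            sum.delta cong: if_cong)
      have gl: "slice_right (f v) w = scl E (f v w) w" if "w \<in> insert u U" for w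
        using insert.prems(1)[OF that]
        by (simp add: slice_right_def sweedler_grouplike[OF bilinear_slice(1)[OF f_hom]])
      have "scl E (c v) u = slice_right (f v) u" using gl[of u] f_u by simp
      also have "\<dots> = (\<Sum>w\<in>U. scl E (c w) (slice_right (f v) w))"
        by (subst c) (simp add: sl.sum sl.scale)
      also have "\<dots> = (\<Sum>w\<in>U. if w = v then scl E (c v) v else 0)"
        by (intro sum.cong) (auto simp: gl f_U)
      also have "\<dots> = scl E (c v) v" using insert.hyps(1) v by simp
      finally have "scl E (c v) (u - v) = 0" by (simp add: scale_right_diff_distrib)
      then show ?thesis using insert.hyps(2) v by auto
    qed
    then have "u = 0" by (subst c) simp
    then show False using insert.prems(2) by simp
  qed
  then show ?case using indep by (rule independent_insertI)
qed

end

section \<open>Normal forms in the Radford algebra\<close>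

context k_algebra
begin

definition radford_monomials :: "'a \<Rightarrow> 'a \<Rightarrow> nat \<Rightarrow> 'a set" where
  "radford_monomials g x p = (\<lambda>(j, l). g ^ j * x ^ l) ` ({..<p} \<times> {..<p})"

lemma radford_monomialsI: "j < p \<Longrightarrow> l < p \<Longrightarrow> g ^ j * x ^ l \<in> radford_monomials g x p"
  by (auto simp: radford_monomials_def)

lemma radford_commutator:
  assumes I: "subspace I" "\<And>a b. a \<in> I \<Longrightarrow> b * a \<in> I" "\<And>a b. a \<in> I \<Longrightarrow> a * b \<in> I"
    and rel: "(g * x - x * g) - g * (1 - g) \<in> I"
  shows "(g ^ j * x - x * g ^ j) - s (of_nat j) (g ^ j * (1 - g)) \<in> I"
proof (induction j)
  case 0
  show ?case by (simp add: subspace_0[OF I(1)])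
next
  case (Suc j)
  have "(g ^ Suc j * x - x * g ^ Suc j) - s (of_nat (Suc j)) (g ^ Suc j * (1 - g))
      = ((g ^ j * x - x * g ^ j) - s (of_nat j) (g ^ j * (1 - g))) * g
        + g ^ j * ((g * x - x * g) - g * (1 - g))"
    by (simp add: algebra_simps mult_scale_left mult_scale_right power_commutes
        flip: power_Suc2)
       (simp add: power_commutes flip: mult.assoc power_Suc)
  then show ?case using I rel Suc.IH by (simp add: subspace_add)
qed

text \<open>
  Moving a letter \<open>x\<close> past \<open>g\<^sup>j\<close> costs only powers of \<open>g\<close>, so the monomials \<open>g\<^sup>jx\<^sup>l\<close> span modulo the
  relations.  Working modulo an ideal covers both the free algebra and an algebra in which the
  relations already hold.
\<close>

lemma radford_span_closed:
  assumes I: "subspace I" "\<And>a b. a \<in> I \<Longrightarrow> b * a \<in> I" "\<And>a b. a \<in> I \<Longrightarrow> a * b \<in> I"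
    and rel: "g ^ p - 1 \<in> I" "x ^ p - x \<in> I" "(g * x - x * g) - g * (1 - g) \<in> I"
    and p: "p > 1" and a: "a \<in> span (radford_monomials g x p \<union> I)"
  shows "g * a \<in> span (radford_monomials g x p \<union> I)"
    and "x * a \<in> span (radford_monomials g x p \<union> I)"
proof -
  let ?M = "span (radford_monomials g x p \<union> I)"
  have IM: "b \<in> I \<Longrightarrow> b \<in> ?M" for b by (simp add: span_base)
  have mon: "g ^ j * x ^ l \<in> ?M" if "j < p" "l < p" for j l
    using that by (simp add: span_base radford_monomialsI)
  have mon_g: "g ^ Suc j * x ^ l \<in> ?M" if "j < p" "l < p" for j l
  proof (cases "Suc j < p")
    case True
    then show ?thesis using that mon by blast
  next
    case False
    then have "Suc j = p" using that by simp
    then have "g ^ Suc j * x ^ l = g ^ 0 * x ^ l + (g ^ p - 1) * x ^ l"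
      by (simp add: algebra_simps)
    then show ?thesis
      using mon[of 0 l] IM[OF I(3)[OF rel(1)]] p that by (simp only: span_add)
  qed
  have mon_x: "g ^ j * x ^ Suc l \<in> ?M" if "j < p" "l < p" for j l
  proof (cases "Suc l < p")
    case True
    then show ?thesis using that mon by blast
  next
    case False
    then have "Suc l = p" using that by simp
    then have "g ^ j * x ^ Suc l = g ^ j * x ^ 1 + g ^ j * (x ^ p - x)"
      by (simp add: algebra_simps)
    then show ?thesis
      using mon[of j 1] IM[OF I(2)[OF rel(2)]] p that by (simp only: span_add)
  qed
  show "g * a \<in> ?M"
  proof (rule span_mult_left[OF _ a])
    fix b assume "b \<in> radford_monomials g x p \<union> I"
    then show "g * b \<in> ?M"
      using mon_g IM I(2) by (auto simp: radford_monomials_def mult.assoc)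
  qed
  show "x * a \<in> ?M"
  proof (rule span_mult_left[OF _ a])
    fix b assume b: "b \<in> radford_monomials g x p \<union> I"
    show "x * b \<in> ?M"
    proof (cases "b \<in> I")
      case False
      then obtain j l where b: "b = g ^ j * x ^ l" "j < p" "l < p"
        using b by (auto simp: radford_monomials_def)
      have "x * b = g ^ j * x ^ Suc l - s (of_nat j) (g ^ j * x ^ l) + s (of_nat j) (g ^ Suc j * x ^ l)
          - ((g ^ j * x - x * g ^ j) - s (of_nat j) (g ^ j * (1 - g))) * x ^ l"
        by (simp add: b(1) algebra_simps mult_scale_left flip: power_Suc2)
      then show ?thesis
        using IM[OF I(3)[OF radford_commutator[OF I rel(3), of j]], of "x ^ l"]
          mon[OF b(2,3)] mon_x[OF b(2,3)] mon_g[OF b(2,3)]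
        by (simp only: span_add span_diff span_scale)
    qed (simp add: IM I(2))
  qed
qed

end

section \<open>Small representations\<close>

text \<open>
  \<open>Tri a b d\<close> is the lower triangular matrix with diagonal entries \<open>a\<close> (upper left) and \<open>d\<close> (lower
  right) and with \<open>b\<close> below the diagonal.
\<close>

datatype 'k tri = Tri (ul: 'k) (ll: 'k) (lr: 'k)

instantiation tri :: (field) ring_1
begin

definition zero_tri :: "'a tri" where "zero_tri = Tri 0 0 0"
definition one_tri :: "'a tri" where "one_tri = Tri 1 0 1"
definition plus_tri :: "'a tri \<Rightarrow> 'a tri \<Rightarrow> 'a tri" where
  "plus_tri M N = Tri (ul M + ul N) (ll M + ll N) (lr M + lr N)"
definition minus_tri :: "'a tri \<Rightarrow> 'a tri \<Rightarrow> 'a tri" where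
  "minus_tri M N = Tri (ul M - ul N) (ll M - ll N) (lr M - lr N)"
definition uminus_tri :: "'a tri \<Rightarrow> 'a tri" where
  "uminus_tri M = Tri (- ul M) (- ll M) (- lr M)"
definition times_tri :: "'a tri \<Rightarrow> 'a tri \<Rightarrow> 'a tri" where
  "times_tri M N = Tri (ul M * ul N) (ll M * ul N + lr M * ll N) (lr M * lr N)"

instance
  by standard (simp_all add: zero_tri_def one_tri_def plus_tri_def minus_tri_def uminus_tri_def
      times_tri_def algebra_simps)

end

definition tri_scale :: "'k::field \<Rightarrow> 'k tri \<Rightarrow> 'k tri" where
  "tri_scale c M = Tri (c * ul M) (c * ll M) (c * lr M)"

lemmas tri_defs = zero_tri_def one_tri_def plus_tri_def minus_tri_def uminus_tri_def
  times_tri_def tri_scale_def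

lemma k_algebra_tri: "k_algebra (tri_scale :: 'k::field \<Rightarrow> _)"
  by unfold_locales (simp_all add: tri_defs algebra_simps)

interpretation tri: k_algebra "tri_scale :: 'k::field \<Rightarrow> 'k tri \<Rightarrow> 'k tri"
  by (rule k_algebra_tri)

lemma tri_unipotent_power: "Tri 1 b 1 ^ m = Tri 1 (of_nat m * b) 1"
  by (induction m) (simp_all add: tri_defs algebra_simps)

lemma tri_diagonal_power: "Tri 1 0 z ^ m = Tri 1 0 (z ^ m)"
  by (induction m) (simp_all add: tri_defs)

lemma alg_closed_nontrivial_root_of_unity:
  assumes "prime (n::nat)" "n \<noteq> CHAR('k::alg_closed_field)"
  obtains z :: "'k::alg_closed_field" where "z ^ n = 1" "z \<noteq> 1"
proof -
  have n: "n - 1 > 0" "Suc (n - 1) = n"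
    using prime_gt_1_nat[OF assms(1)] by auto
  obtain z :: 'k where z: "(\<Sum>k\<le>n - 1. 1 * z ^ k) = 0"
    using alg_closed[OF n(1), of "\<lambda>_. 1"] by auto
  have "z ^ n - 1 = (z - 1) * (\<Sum>k\<le>n - 1. 1 * z ^ k)"
    using power_diff_1_eq[of z n] n by (simp add: lessThan_Suc_atMost[symmetric])
  then have "z ^ n = 1" using z by simp
  moreover have "z \<noteq> 1"
  proof
    assume "z = 1"
    then have "of_nat n = (0::'k)" using z n by (simp del: of_nat_Suc)
    then have "CHAR('k) dvd n" by (simp add: of_nat_eq_0_iff_char_dvd)
    then show False
      using assms CHAR_not_1'[where ?'a = 'k] by (auto simp: prime_nat_iff)
  qed
  ultimately show ?thesis using that by blast
qed

text \<open>
  A unipotent matrix has order \<open>n\<close> in characteristic \<open>n\<close>; in other characteristics there is a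
  nontrivial \<open>n\<close>-th root of unity to put on the diagonal.
\<close>

lemma exists_tri_of_prime_order:
  assumes "prime (n::nat)"
  obtains M :: "'k::alg_closed_field tri" where "M ^ n = 1" "M \<noteq> 1"
proof (cases "n = CHAR('k)")
  case True
  then show ?thesis using that[of "Tri 1 1 1"] by (simp add: tri_unipotent_power one_tri_def)
next
  case False
  then obtain z :: 'k where "z ^ n = 1" "z \<noteq> 1"
    using alg_closed_nontrivial_root_of_unity assms by blast
  then show ?thesis using that[of "Tri 1 0 z"] by (simp add: tri_diagonal_power one_tri_def)
qed

lemma power_coprime_order:
  fixes y :: "'a::monoid_mult"
  assumes "y ^ n = 1" "coprime i n"
  obtains e where "(y ^ i) ^ e = y"
proof (cases "n = 0")
  case True
  then show ?thesis using that[of 1] assms(2) by simp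
next
  case False
  obtain e where "[i * e = Suc 0] (mod n)"
    using cong_solve_coprime_nat[OF assms(2)] by blast
  moreover have "y ^ (a mod n) = y ^ a" for a
    using assms(1) by (metis mod_mult_div_eq mult_1_right power_add power_mult power_one)
  ultimately have "y ^ (i * e) = y ^ 1" by (metis cong_def One_nat_def)
  then show ?thesis using that[of e] by (simp add: power_mult)
qed

section \<open>A monomial basis\<close>

locale E_alpha_prime = E_alpha E n \<alpha> g h x
  for E :: "('k::alg_closed_field, 'e::ring_1) hopf" (structure)
    and n :: nat and \<alpha> :: 'k and g h x :: 'e +
  fixes p :: nat
  assumes prime_n: "prime n" and CHAR_eq [simp]: "CHAR('k) = p" and p_pos: "p > 0"
begin

lemma prime_p: "prime p"
  using prime_CHAR_semidom[where ?'a = 'k] p_pos by simp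

lemma p_gt_1: "p > 1" and n_gt_1: "n > 1"
  using prime_p prime_n prime_gt_1_nat by blast+

lemma of_nat_p: "of_nat p = (0::'k)"
  using of_nat_CHAR[where ?'a = 'k] by simp

lemma of_nat_n_alpha: "of_nat n * \<alpha> = 0"
  using parameter by (cases "p dvd n") (auto simp: of_nat_eq_0_iff_char_dvd)

lemma relation: "r \<in> E_relators n \<alpha> \<Longrightarrow> alg_eval (scl E) (E_assign g h x) r = 0"
  using presentation two_sided_ideal_base[of r]
  by (auto simp: presented_by_def eval_free_eq_alg_eval)

lemma g_power_p: "g ^ p = 1"
  using relation[of "gen Eg ^ p - 1"] by (simp add: E_relators_def Let_def alg_eval_simps)

lemma h_power_n: "h ^ n = 1"
  using relation[of "gen Eh ^ n - 1"] by (simp add: E_relators_def Let_def alg_eval_simps)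

lemma x_power_p: "x ^ p = x"
  using relation[of "gen Ex ^ p - gen Ex"] by (simp add: E_relators_def Let_def alg_eval_simps)

lemma g_h: "g * h = h * g"
  using relation[of "gen Eg * gen Eh - gen Eh * gen Eg"]
  by (simp add: E_relators_def Let_def alg_eval_simps)

lemma g_x: "g * x - x * g = g * (1 - g)"
  using relation[of "(gen Eg * gen Ex - gen Ex * gen Eg) - gen Eg * (1 - gen Eg)"]
  by (simp add: E_relators_def Let_def alg_eval_simps)

lemma x_h: "x * h - h * x = scl E \<alpha> (h * (1 - g))"
  using relation[of "(gen Ex * gen Eh - gen Eh * gen Ex) - fscale \<alpha> (gen Eh * (1 - gen Eg))"]
  by (simp add: E_relators_def Let_def alg_eval_simps)

lemma g_power_x: "g ^ j * x - x * g ^ j = scl E (of_nat j) (g ^ j * (1 - g))"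
  using radford_commutator[of "{0}" g x j] g_x by simp

lemma power_g_h: "g ^ j * h ^ i = h ^ i * g ^ j"
  by (rule power_commuting_commutes[OF power_commuting_commutes[OF g_h, symmetric], symmetric])

lemma x_h_power: "x * h ^ i = h ^ i * x + scl E (of_nat i * \<alpha>) (h ^ i * (1 - g))"
proof (induction i)
  case (Suc i)
  have xh: "x * h = h * x + scl E \<alpha> (h * (1 - g))"
    using x_h by (simp add: algebra_simps)
  have "x * h ^ Suc i = (x * h ^ i) * h" by (simp add: power_commutes mult.assoc)
  also have "\<dots> = h ^ i * (x * h) + scl E (of_nat i * \<alpha>) (h ^ i * (h * (1 - g)))"
    using g_h by (simp add: Suc.IH algebra_simps mult_scale_left)
  also have "\<dots> = h ^ Suc i * x + scl E (of_nat (Suc i) * \<alpha>) (h ^ Suc i * (1 - g))"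
    by (simp add: xh algebra_simps mult_scale_right power_commutes)
       (simp add: power_commutes flip: mult.assoc power_Suc)
  finally show ?case .
qed simp

text \<open>
  As \<open>g\<close> and \<open>h\<close> have finite order, natural exponents suffice to obtain the group generated by them.
\<close>

definition group_elems :: "'e set" where
  "group_elems = {h ^ i * g ^ j |i j::nat. True}"

lemma group_elemsI: "h ^ i * g ^ j \<in> group_elems"
  by (auto simp: group_elems_def)

lemma h_power_group: "h ^ i \<in> group_elems" and g_power_group: "g ^ j \<in> group_elems"
  using group_elemsI[of i 0] group_elemsI[of 0 j] by simp_all

lemma group_mult_eq: "(h ^ i * g ^ j) * (h ^ i' * g ^ j') = h ^ (i + i') * g ^ (j + j')"
proof -
  have "(h ^ i * g ^ j) * (h ^ i' * g ^ j') = h ^ i * (g ^ j * h ^ i') * g ^ j'"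
    by (simp add: mult.assoc)
  then show ?thesis by (simp add: power_g_h power_add mult.assoc)
qed

lemma group_power_eq: "(h ^ i * g ^ j) ^ m = h ^ (i * m) * g ^ (j * m)"
  by (induction m) (simp_all add: group_mult_eq)

lemma group_mult: "u \<in> group_elems \<Longrightarrow> v \<in> group_elems \<Longrightarrow> u * v \<in> group_elems"
  unfolding group_elems_def using group_mult_eq by fastforce

lemma g_power_mod: "g ^ (j mod p) = g ^ j"
  by (metis g_power_p mod_mult_div_eq mult_1_right power_add power_mult power_one)

lemma h_power_mod: "h ^ (i mod n) = h ^ i"
  by (metis h_power_n mod_mult_div_eq mult_1_right power_add power_mult power_one)

lemma group_power_order: "u \<in> group_elems \<Longrightarrow> u ^ (n * p) = 1"
proof -
  have "h ^ (i * (n * p)) = 1" for i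
    by (metis h_power_n mult.commute mult.left_commute power_mult power_one)
  moreover have "g ^ (j * (n * p)) = 1" for j
    by (metis g_power_p mult.commute mult.left_commute power_mult power_one)
  ultimately show "u \<in> group_elems \<Longrightarrow> u ^ (n * p) = 1"
    by (auto simp: group_elems_def group_power_eq)
qed

lemma group_inverse:
  assumes "u \<in> group_elems"
  shows "u * u ^ (n * p - 1) = 1" "u ^ (n * p - 1) * u = 1"
proof -
  have "n * p = Suc (n * p - 1)" using n_pos p_pos by simp
  then show "u * u ^ (n * p - 1) = 1" "u ^ (n * p - 1) * u = 1"
    using group_power_order[OF assms] by (metis power_Suc, metis power_Suc2)
qed

lemma group_power_mem: "u \<in> group_elems \<Longrightarrow> u ^ m \<in> group_elems"
  by (induction m) (use group_elemsI[of 0 0] in \<open>simp_all add: group_mult\<close>)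

lemma group_left_cancel: "u \<in> group_elems \<Longrightarrow> u * a = u * b \<longleftrightarrow> a = b"
  by (metis group_inverse(2) mult.assoc mult_1_left)

lemma group_nonzero: "u \<in> group_elems \<Longrightarrow> u \<noteq> 0"
  using group_inverse(1)[of u] by auto

lemma group_elems_image: "group_elems = (\<lambda>(i, j). h ^ i * g ^ j) ` ({..<n} \<times> {..<p})"
proof -
  have "h ^ i * g ^ j \<in> (\<lambda>(i, j). h ^ i * g ^ j) ` ({..<n} \<times> {..<p})" for i j
    using n_pos p_pos g_power_mod[of j] h_power_mod[of i]
    by (intro image_eqI[of _ _ "(i mod n, j mod p)"]) auto
  then show ?thesis by (auto simp: group_elems_def)
qed

lemma finite_group: "finite group_elems"
  by (simp add: group_elems_image)

lemma grouplike_group: "u \<in> group_elems \<Longrightarrow> grouplike E u"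
  using comult_g comult_h
  by (auto simp: group_elems_def grouplike_def[symmetric] intro!: grouplike_mult grouplike_power)

text \<open>
  In this representation \<open>g\<close> is unipotent of order \<open>p\<close>.  Moreover \<open>g\<close> and \<open>h\<close>, hence all elements of
  their group algebra, have equal diagonal entries, in contrast to \<open>x\<close>.
\<close>

lemma triangular_representation:
  obtains \<rho> where "module_hom (scl E) tri_scale \<rho>" "\<And>a b. \<rho> (a * b) = \<rho> a * \<rho> b" "\<rho> 1 = 1"
    "\<rho> g = Tri 1 (- 1) 1" "\<rho> h = Tri 1 \<alpha> 1" "\<rho> x = Tri 0 0 1"
proof -
  let ?\<psi> = "E_assign (Tri 1 (- 1) 1) (Tri 1 \<alpha> 1) (Tri 0 0 1)"
  have x: "Tri 0 0 1 ^ m = Tri 0 0 1" if "m > 0" for m :: nat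
    using that by (induction m rule: nat_induct_non_zero) (simp_all add: tri_defs)
  have "alg_eval tri_scale ?\<psi> r = 0" if "r \<in> E_relators n \<alpha>" for r
    using that unfolding E_relators_def Let_def
    by (elim insertE emptyE)
       (simp_all add: tri.alg_eval_simps tri_unipotent_power of_nat_n_alpha x p_pos of_nat_p,
         simp_all add: tri_defs)
  then obtain \<rho> where "module_hom (scl E) tri_scale \<rho>" "\<And>a b. \<rho> (a * b) = \<rho> a * \<rho> b" "\<rho> 1 = 1"
    "\<And>i. \<rho> (E_assign g h x i) = ?\<psi> i"
    using presented_by_hom[OF k_algebra_axioms k_algebra_tri presentation, of ?\<psi>] by metis
  from this(1-3) this(4)[of Eg] this(4)[of Eh] this(4)[of Ex] show ?thesis
    using that by simp
qed

text \<open>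
  Sending \<open>g\<close> to \<open>1\<close> and \<open>x\<close> to \<open>0\<close> reduces the defining relations to \<open>h\<^sup>n = 1\<close>, so a matrix of order \<open>n\<close>
  detects the exponent of \<open>h\<close>; the triangular representation then detects the exponent of \<open>g\<close>.
\<close>

lemma order_of_monomial:
  assumes "h ^ i * g ^ j = 1"
  shows "n dvd i" "p dvd j"
proof -
  obtain M :: "'k tri" where M: "M ^ n = 1" "M \<noteq> 1"
    by (rule exists_tri_of_prime_order[OF prime_n])
  let ?\<psi> = "E_assign 1 M 0"
  have "alg_eval tri_scale ?\<psi> r = 0" if "r \<in> E_relators n \<alpha>" for r
    using that unfolding E_relators_def Let_def
    by (elim insertE emptyE) (simp_all add: tri.alg_eval_simps M p_pos zero_power)
  then obtain \<rho> where \<rho>: "\<And>a b. \<rho> (a * b) = \<rho> a * \<rho> b" "\<rho> 1 = 1"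
    "\<And>i. \<rho> (E_assign g h x i) = ?\<psi> i"
    using presented_by_hom[OF k_algebra_axioms k_algebra_tri presentation, of ?\<psi>] by metis
  have pow: "\<rho> (a ^ m) = \<rho> a ^ m" for a m by (induction m) (simp_all add: \<rho>)
  have "M ^ i = 1"
    using arg_cong[OF assms, of \<rho>] \<rho>(3)[of Eg] \<rho>(3)[of Eh] by (simp add: \<rho>(1,2) pow)
  show "n dvd i"
  proof (rule ccontr)
    assume "\<not> n dvd i"
    then have "coprime i n" using prime_n prime_imp_coprime coprime_commute by blast
    then obtain e where "(M ^ i) ^ e = M" using power_coprime_order M(1) by blast
    then show False using \<open>M ^ i = 1\<close> M(2) by simp
  qed
  then have gj: "g ^ j = 1" using assms h_power_n by (auto simp: power_mult)
  obtain \<sigma> where \<sigma>: "\<And>a b. \<sigma> (a * b) = \<sigma> a * \<sigma> b" "\<sigma> 1 = 1" "\<sigma> g = Tri 1 (- 1 :: 'k) 1"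
    using triangular_representation by metis
  have pow: "\<sigma> (a ^ m) = \<sigma> a ^ m" for a m by (induction m) (simp_all add: \<sigma>)
  have "Tri 1 (- of_nat j) 1 = (1 :: 'k tri)"
    using arg_cong[OF gj, of \<sigma>] by (simp add: pow \<sigma> tri_unipotent_power)
  then show "p dvd j" by (simp add: one_tri_def of_nat_eq_0_iff_char_dvd)
qed

lemma monomial_eq_iff:
  assumes "i < n" "i' < n" "j < p" "j' < p"
  shows "h ^ i * g ^ j = h ^ i' * g ^ j' \<longleftrightarrow> i = i' \<and> j = j'"
proof
  assume eq: "h ^ i * g ^ j = h ^ i' * g ^ j'"
  have "h ^ (i' + (n - i')) * g ^ (j' + (p - j')) = 1"
    using assms h_power_n g_power_p by simp
  then have "h ^ (i + (n - i')) * g ^ (j + (p - j')) = 1"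
    using eq by (simp only: flip: group_mult_eq)
  from order_of_monomial[OF this] have n: "n dvd i + (n - i')" and p: "p dvd j + (p - j')" .
  \<comment> \<open>The sum \<open>a + (m - b)\<close> lies strictly between \<open>0\<close> and \<open>2m\<close>, so it is \<open>m\<close>.\<close>
  have dvd: "a = b" if m: "m dvd a + (m - b)" "a < m" "b < m" for a b m :: nat
  proof -
    obtain k where k: "a + (m - b) = m * k" using m(1) by (rule dvdE)
    have "0 < m * k" "m * k < m * 2" using m by (simp_all flip: k)
    then have "k = 1" by (simp add: mult_less_cancel1)
    then show ?thesis using k m by simp
  qed
  show "i = i' \<and> j = j'" using dvd[OF n] dvd[OF p] assms by blast
qed simp

lemma card_group: "card group_elems = n * p"
proof -
  have "inj_on (\<lambda>(i, j). h ^ i * g ^ j) ({..<n} \<times> {..<p})"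
    by (rule inj_onI) (auto simp: monomial_eq_iff)
  then show ?thesis by (simp add: group_elems_image card_image)
qed

lemma x_notin_span_group: "x \<notin> span group_elems"
proof
  assume x: "x \<in> span group_elems"
  obtain \<rho> :: "'e \<Rightarrow> 'k tri" where \<rho>: "module_hom (scl E) tri_scale \<rho>"
    "\<And>a b. \<rho> (a * b) = \<rho> a * \<rho> b" "\<rho> 1 = 1"
    "\<rho> g = Tri 1 (- 1) 1" "\<rho> h = Tri 1 \<alpha> 1" "\<rho> x = Tri 0 0 1"
    using triangular_representation by metis
  have pow: "\<rho> (a ^ m) = \<rho> a ^ m" for a m by (induction m) (simp_all add: \<rho>)
  have "tri.subspace {M :: 'k tri. ul M = lr M}"
    by (rule tri.subspaceI) (auto simp: tri_defs)
  then have "subspace (\<rho> -` {M. ul M = lr M})"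
    by (rule module_hom.subspace_vimage[OF \<rho>(1)])
  moreover have "group_elems \<subseteq> \<rho> -` {M. ul M = lr M}"
    by (auto simp: group_elems_def \<rho> pow tri_unipotent_power times_tri_def)
  ultimately have "x \<in> \<rho> -` {M. ul M = lr M}" using x span_minimal by blast
  then show False by (simp add: \<rho>)
qed

lemma radford_span_mult:
  assumes "a \<in> span (radford_monomials g x p)"
  shows "g * a \<in> span (radford_monomials g x p)" "x * a \<in> span (radford_monomials g x p)"
proof -
  have eq: "span (radford_monomials g x p \<union> {0}) = span (radford_monomials g x p)"
    by (simp add: span_Un)
  show "g * a \<in> span (radford_monomials g x p)" "x * a \<in> span (radford_monomials g x p)"
    using radford_span_closed[of "{0}" g p x a] assms
    using p_gt_1 by (simp_all add: eq g_power_p x_power_p g_x)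
qed

text \<open>
  This is the left factor that accompanies \<open>x\<^sup>l\<close> in \<open>\<Delta>(x\<^sup>l\<^sup>+\<^sup>1)\<close>.  Each of the \<open>l + 1\<close> words has the form
  \<open>g\<^sup>i x g\<^sup>l\<^sup>-\<^sup>i\<close> and equals \<open>g\<^sup>l x\<close> up to powers of \<open>g\<close>; the coefficient \<open>l + 1\<close> is nonzero in \<open>k\<close> as long
  as \<open>l + 1 < p\<close>.
\<close>

lemma word_sum_subdiag:
  obtains c where "word_sum g x (Suc l) l
    = scl E (of_nat (Suc l)) (g ^ l * x) + scl E c (g ^ l * (1 - g))"
proof -
  have "\<exists>c. word_sum g x (Suc l) l
    = scl E (of_nat (Suc l)) (g ^ l * x) + scl E c (g ^ l * (1 - g))"
  proof (induction l)
    case 0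
    show ?case by (auto intro: exI[of _ 0])
  next
    case (Suc l)
    then obtain c where c: "word_sum g x (Suc l) l
      = scl E (of_nat (Suc l)) (g ^ l * x) + scl E c (g ^ l * (1 - g))" by blast
    have two: "scl E 2 a = a + a" for a
      by (metis one_add_one scale_left_distrib scale_one)
    have xg: "x * g ^ Suc l = g ^ Suc l * x - scl E (of_nat (Suc l)) (g ^ Suc l * (1 - g))"
      using g_power_x[of "Suc l"] by (simp add: algebra_simps)
    have "word_sum g x (Suc (Suc l)) (Suc l) = x * g ^ Suc l + g * word_sum g x (Suc l) l"
      by (simp only: word_sum.simps word_sum_diag)
    also have "\<dots> = scl E (of_nat (Suc (Suc l))) (g ^ Suc l * x)
        + scl E (c - of_nat (Suc l)) (g ^ Suc l * (1 - g))"
      using two[of "g * (g ^ l * x)"] unfolding xg c by (simp add: algebra_simps mult_scale_right)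
    finally show ?case by blast
  qed
  then show ?thesis using that by blast
qed

definition monomial :: "'e \<times> nat \<Rightarrow> 'e" where
  "monomial = (\<lambda>(u, l). u * x ^ l)"

abbreviation exponents :: "('e \<times> nat) set" where
  "exponents \<equiv> group_elems \<times> {..<p}"

lemma monomial_eq [simp]: "monomial (u, l) = u * x ^ l"
  by (simp add: monomial_def)

lemma finite_exponents: "finite exponents"
  by (simp add: finite_group)

lemma slice_right_monomial:
  assumes f: "module_hom (scl E) (*) f" and u: "u \<in> group_elems"
  shows "slice_right f (u * x ^ l) = (\<Sum>m\<le>l. scl E (f (u * x ^ m)) (u * word_sum g x l m))"
  unfolding slice_right_def
  by (rule sweedler_grouplike_power[OF bilinear_slice(1)[OF f] grouplike_group[OF u] comult_x])

lemma slice_right_hom: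
  "module_hom (scl E) (*) f \<Longrightarrow> module_hom (scl E) (scl E) (slice_right f)"
  unfolding slice_right_def by (intro sweedler_hom bilinear_slice)

lemma slice_left_hom:
  "module_hom (scl E) (*) f \<Longrightarrow> module_hom (scl E) (scl E) (slice_left f)"
  unfolding slice_left_def by (intro sweedler_hom bilinear_slice)

lemma span_group_mult: "u \<in> group_elems \<Longrightarrow> a \<in> span group_elems \<Longrightarrow> u * a \<in> span group_elems"
  by (erule span_mult_left[rotated]) (simp add: span_base group_mult)

lemma independent_group: "independent group_elems"
  using independent_grouplike[OF finite_group grouplike_group] group_nonzero by blast

text \<open>
  Slicing by the coordinate of \<open>u x\<^sup>l\<^sup>-\<^sup>1\<close> isolates, modulo the span of the group, the term \<open>u x\<^sup>l\<close> and
  turns it into a multiple of \<open>u g\<^sup>l\<^sup>-\<^sup>1 x\<close>.  So a relation among monomials of degree at most \<open>l\<close> that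
  involved degree \<open>l\<close> would put \<open>x\<close> into the span of the group.
\<close>

lemma indep_monomials_upto:
  assumes "L \<le> p"
  shows "indep_family (scl E) monomial (group_elems \<times> {..<L})"
  using assms
proof (induction L)
  case 0
  show ?case by (simp add: indep_family_def)
next
  case (Suc L)
  show ?case
  proof (cases L)
    case 0
    have "inj_on monomial (group_elems \<times> {..<Suc L})"
      by (auto simp: inj_on_def 0)
    moreover have "monomial ` (group_elems \<times> {..<Suc L}) = group_elems"
      by (force simp: 0 image_iff)
    ultimately show ?thesis
      using independent_indep_family[of monomial] independent_group finite_group by simp
  next
    case (Suc L')
    have indep: "indep_family (scl E) monomial (group_elems \<times> {..<L})"
      using Suc.IH Suc.prems by simp
    obtain f where f_hom: "\<And>k. module_hom (scl E) (*) (f k)"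
      and f_eq: "\<And>k k'. k \<in> group_elems \<times> {..<L} \<Longrightarrow> k' \<in> group_elems \<times> {..<L} \<Longrightarrow>
        f k (monomial k') = (if k = k' then 1 else 0)"
      using indep_family_dual_functionals[OF indep] finite_group by (metis finite_SigmaI finite_lessThan)
    \<comment> \<open>The functional \<open>f (u, L')\<close> is prescribed in degrees below \<open>L\<close> only.  Its values in degree \<open>L\<close>
      occur in the slice as coefficients of group elements, so modulo the group they drop out.\<close>
    have slice: "slice_right (f (u, L')) (monomial (v, l))
        - (if v = u \<and> l = L then u * word_sum g x L L' else 0) \<in> span group_elems"
      if u: "u \<in> group_elems" and v: "v \<in> group_elems" and l: "l \<le> L" for u v l
    proof (cases "l = L")
      case True
      have "slice_right (f (u, L')) (monomial (v, l)) =
         (\<Sum>m<L. scl E (f (u, L') (monomial (v, m))) (v * word_sum g x L m))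
           + scl E (f (u, L') (v * x ^ L)) (v * word_sum g x L L)"
        by (simp add: slice_right_monomial[OF f_hom v] True lessThan_Suc_atMost[symmetric])
      also have "(\<Sum>m<L. scl E (f (u, L') (monomial (v, m))) (v * word_sum g x L m))
         = (\<Sum>m<L. if m = L' then (if v = u then u * word_sum g x L L' else 0) else 0)"
        using u v Suc by (intro sum.cong) (auto simp: f_eq simp del: monomial_eq)
      also have "\<dots> = (if v = u then u * word_sum g x L L' else 0)"
        using Suc by simp
      finally show ?thesis
        using True v by (simp add: word_sum_diag span_scale span_base group_mult g_power_group)
    next
      case False
      then have l: "l < L" using l by simp
      have "scl E (f (u, L') (monomial (v, m))) (v * word_sum g x l m) \<in> span group_elems"
        if m: "m \<le> l" for m
      proof (cases "m = l")
        case True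
        then show ?thesis
          using v by (simp add: word_sum_diag span_scale span_base group_mult g_power_group)
      next
        case False
        then have "f (u, L') (monomial (v, m)) = 0"
          using m l u v Suc by (subst f_eq) auto
        then show ?thesis by (simp add: span_zero)
      qed
      then show ?thesis
        using False by (auto simp: slice_right_monomial[OF f_hom v] intro!: span_sum)
    qed
    have top: "c (u, L) = 0"
      if sum0: "(\<Sum>k\<in>group_elems \<times> {..<Suc L}. scl E (c k) (monomial k)) = 0"
        and u: "u \<in> group_elems" for c u
    proof -
      let ?K = "group_elems \<times> {..<Suc L}"
      let ?d = "\<lambda>k. if k = (u, L) then u * word_sum g x L L' else 0"
      interpret sl: module_hom "scl E" "scl E" "slice_right (f (u, L'))"
        by (rule slice_right_hom[OF f_hom])
      have "(\<Sum>k\<in>?K. scl E (c k) (slice_right (f (u, L')) (monomial k) - ?d k)) \<in> span group_elems"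
      proof (intro span_sum span_scale)
        fix k assume "k \<in> ?K"
        then obtain v l where k: "k = (v, l)" "v \<in> group_elems" "l \<le> L" by auto
        show "slice_right (f (u, L')) (monomial k) - ?d k \<in> span group_elems"
          using slice[OF u k(2,3)] by (simp add: k(1) del: monomial_eq)
      qed
      also have "(\<Sum>k\<in>?K. scl E (c k) (slice_right (f (u, L')) (monomial k) - ?d k))
          = slice_right (f (u, L')) (\<Sum>k\<in>?K. scl E (c k) (monomial k)) - (\<Sum>k\<in>?K. scl E (c k) (?d k))"
        by (simp add: scale_right_diff_distrib sum_subtractf sl.sum sl.scale del: monomial_eq)
      also have "(\<Sum>k\<in>?K. scl E (c k) (?d k)) = (\<Sum>k\<in>?K. if k = (u, L) then scl E (c k) (u * word_sum g x L L') else 0)"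
        by (rule sum.cong) auto
      also have "\<dots> = scl E (c (u, L)) (u * word_sum g x L L')"
        using u finite_group by simp
      finally have "- scl E (c (u, L)) (u * word_sum g x L L') \<in> span group_elems"
        by (simp add: sum0 sl.zero)
      then have mem: "scl E (c (u, L)) (u * word_sum g x L L') \<in> span group_elems"
        using span_neg by fastforce
      obtain b where b: "word_sum g x (Suc L') L'
          = scl E (of_nat (Suc L')) (g ^ L' * x) + scl E b (g ^ L' * (1 - g))"
        by (rule word_sum_subdiag)
      let ?v = "u * g ^ L'"
      have v: "?v \<in> group_elems" using u by (simp add: group_mult g_power_group)
      have "?v * g \<in> group_elems" using group_mult[OF v] g_power_group[of 1] by simp
      then have "?v * (1 - g) \<in> span group_elems"
        using v by (simp add: right_diff_distrib span_diff span_base)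
      then have "scl E (c (u, L)) (u * word_sum g x L L') - scl E (c (u, L) * b) (?v * (1 - g)) \<in> span group_elems"
        using mem by (simp add: span_diff span_scale)
      also have "scl E (c (u, L)) (u * word_sum g x L L') - scl E (c (u, L) * b) (?v * (1 - g))
          = scl E (c (u, L) * of_nat L) (?v * x)"
        by (simp only: Suc b) (simp add: algebra_simps mult_scale_right)
      finally have "?v ^ (n * p - 1) * scl E (c (u, L) * of_nat L) (?v * x) \<in> span group_elems"
        using v by (simp add: span_group_mult group_power_mem)
      then have "scl E (c (u, L) * of_nat L) x \<in> span group_elems"
        using group_inverse(2)[OF v] by (simp add: mult_scale_right flip: mult.assoc)
      then have inv: "scl E (inverse (c (u, L) * of_nat L)) (scl E (c (u, L) * of_nat L) x)
          \<in> span group_elems"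
        by (rule span_scale)
      have "c (u, L) * of_nat L = 0"
      proof (rule ccontr)
        assume "c (u, L) * of_nat L \<noteq> 0"
        then have "inverse (c (u, L) * of_nat L) * (c (u, L) * of_nat L) = 1"
          by (rule left_inverse)
        then show False using inv x_notin_span_group unfolding scale_scale by simp
      qed
      moreover have "of_nat L \<noteq> (0::'k)"
        using nat_dvd_not_less[of L p] Suc.prems Suc unfolding of_nat_eq_0_iff_char_dvd by simp
      ultimately show ?thesis by simp
    qed
    show ?thesis
      unfolding indep_family_def
    proof (intro allI impI ballI)
      fix c k
      assume sum0: "(\<Sum>k\<in>group_elems \<times> {..<Suc L}. scl E (c k) (monomial k)) = 0"
        and k: "k \<in> group_elems \<times> {..<Suc L}"
      have "(\<Sum>k\<in>group_elems \<times> {..<L}. scl E (c k) (monomial k))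
          = (\<Sum>k\<in>group_elems \<times> {..<Suc L}. scl E (c k) (monomial k))"
        using top[OF sum0] finite_group
        by (intro sum.mono_neutral_left) (auto simp: less_Suc_eq)
      then have "\<forall>k\<in>group_elems \<times> {..<L}. c k = 0"
        using indep sum0 unfolding indep_family_def by auto
      then show "c k = 0" using k top[OF sum0] by (auto simp: less_Suc_eq)
    qed
  qed
qed

lemma indep_monomials: "indep_family (scl E) monomial exponents"
  by (rule indep_monomials_upto) simp

lemma UNIV_subset_closed:
  assumes "subspace M" "1 \<in> M" "\<And>a. a \<in> M \<Longrightarrow> g * a \<in> M" "\<And>a. a \<in> M \<Longrightarrow> h * a \<in> M"
    "\<And>a. a \<in> M \<Longrightarrow> x * a \<in> M"
  shows "M = UNIV"
proof -
  have "range (alg_eval (scl E) (E_assign g h x)) \<subseteq> M"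
  proof (rule range_alg_eval_subset[OF assms(1,2)])
    fix i a assume "a \<in> M"
    then show "E_assign g h x i * a \<in> M" using assms(3-5) by (cases i) auto
  qed
  then show ?thesis
    using presentation by (auto simp: presented_by_def eval_free_eq_alg_eval)
qed

lemma span_monomials: "span (monomial ` exponents) = UNIV"
proof (rule UNIV_subset_closed)
  let ?M = "span (monomial ` exponents)"
  have mon: "u * x ^ l \<in> ?M" if "u \<in> group_elems" "l < p" for u l
    using that by (auto intro!: span_base image_eqI[of _ _ "(u, l)"])
  show "1 \<in> ?M" using mon[of 1 0] g_power_group[of 0] p_pos by simp
  have group: "v * a \<in> ?M" if "v \<in> group_elems" "a \<in> ?M" for v a
    using that by (auto intro!: span_mult_left[OF _ that(2)] mon simp: group_mult simp flip: mult.assoc)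
  show "g * a \<in> ?M" "h * a \<in> ?M" if "a \<in> ?M" for a
    using group[OF g_power_group[of 1] that] group[OF h_power_group[of 1] that] by simp_all
  show "x * a \<in> ?M" if "a \<in> ?M" for a
  proof (rule span_mult_left[OF _ that])
    fix b assume "b \<in> monomial ` exponents"
    then obtain i j l where b: "b = h ^ i * g ^ j * x ^ l" and jl: "j < p" "l < p"
      by (auto simp: group_elems_image)
    have "x * (g ^ j * x ^ l) \<in> span (radford_monomials g x p)"
      using jl by (intro radford_span_mult(2) span_base) (simp add: radford_monomialsI)
    moreover have "radford_monomials g x p \<subseteq> monomial ` exponents"
      by (force simp: radford_monomials_def g_power_group)
    ultimately have "h ^ i * (x * (g ^ j * x ^ l)) \<in> ?M"
      using span_mono h_power_group by (blast intro: group)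
    moreover have "h ^ i * (g ^ j * x ^ l) \<in> ?M" "h ^ i * (g ^ Suc j * x ^ l) \<in> ?M"
      using jl by (simp_all only: mon group_elemsI flip: mult.assoc)
    moreover have "x * b = h ^ i * (x * (g ^ j * x ^ l))
       + scl E (of_nat i * \<alpha>) (h ^ i * (g ^ j * x ^ l) - h ^ i * (g ^ Suc j * x ^ l))"
    proof -
      have "x * b = (x * h ^ i) * (g ^ j * x ^ l)" by (simp add: b mult.assoc)
      then show ?thesis by (simp add: x_h_power algebra_simps mult_scale_left)
    qed
    ultimately show "x * b \<in> ?M" by (simp only: span_add span_diff span_scale)
  qed
qed simp

definition coord :: "'e \<Rightarrow> nat \<Rightarrow> 'e \<Rightarrow> 'k" where
  "coord u l a = representation (monomial ` exponents) a (u * x ^ l)"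

lemma monomial_basis: "independent (monomial ` exponents)" "inj_on monomial exponents"
  using indep_family_independent[OF indep_monomials] indep_family_inj_on[OF indep_monomials]
    finite_exponents by blast+

lemma coord_hom: "module_hom (scl E) (*) (coord u l)"
  unfolding coord_def
  by (simp add: module_hom_iff module_s representation_add representation_scale monomial_basis
      span_monomials)
     (unfold_locales, auto simp: algebra_simps)

lemma coord_monomial:
  assumes "u \<in> group_elems" "l < p" "v \<in> group_elems" "m < p"
  shows "coord u l (v * x ^ m) = (if u = v \<and> l = m then 1 else 0)"
proof -
  have "v * x ^ m \<in> monomial ` exponents"
    using assms by (auto intro!: image_eqI[of _ _ "(v, m)"])
  moreover have "u * x ^ l = v * x ^ m \<longleftrightarrow> u = v \<and> l = m"
    using inj_on_eq_iff[OF monomial_basis(2), of "(u, l)" "(v, m)"] assms by simp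
  ultimately show ?thesis
    using representation_basis[OF monomial_basis(1), of "v * x ^ m"] by (auto simp: coord_def)
qed

lemma coord_group:
  assumes "u \<in> group_elems" "l < p" "v \<in> group_elems"
  shows "coord u l v = (if u = v \<and> l = 0 then 1 else 0)"
  using coord_monomial[OF assms(1,2,3), of 0] p_pos by simp

lemma coord_expansion: "a = (\<Sum>u\<in>group_elems. \<Sum>l<p. scl E (coord u l a) (u * x ^ l))"
proof -
  have "a = (\<Sum>b\<in>monomial ` exponents. scl E (representation (monomial ` exponents) a b) b)"
    using sum_representation_eq[of "monomial ` exponents" a "monomial ` exponents"]
      monomial_basis span_monomials finite_exponents by simp
  also have "\<dots> = (\<Sum>k\<in>exponents. scl E (representation (monomial ` exponents) a (monomial k)) (monomial k))"
    by (simp add: sum.reindex[OF monomial_basis(2)])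
  also have "\<dots> = (\<Sum>u\<in>group_elems. \<Sum>l<p. scl E (coord u l a) (u * x ^ l))"
    by (simp add: sum.cartesian_product coord_def case_prod_beta monomial_def)
  finally show ?thesis .
qed

lemma mem_spanI_coord:
  assumes "\<And>u l. u \<in> group_elems \<Longrightarrow> l < p \<Longrightarrow> coord u l a \<noteq> 0 \<Longrightarrow> u * x ^ l \<in> span S"
  shows "a \<in> span S"
  by (subst coord_expansion) (metis (no_types, lifting) assms lessThan_iff scale_zero_left span_scale span_sum span_zero)

end

section \<open>Hopf subalgebras\<close>

lemma formal_tensors_subspace: "formal.subspace (formal_tensors V W :: ('a \<times> 'a \<Rightarrow>\<^sub>0 'k::field) set)"
proof (rule formal.subspaceI)
  show "t + t' \<in> formal_tensors V W" if "t \<in> formal_tensors V W" "t' \<in> formal_tensors V W"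
    for t t' :: "'a \<times> 'a \<Rightarrow>\<^sub>0 'k"
    using that Poly_Mapping.keys_add[of t t'] by (auto simp: formal_tensors_def)
  show "fscale c t \<in> formal_tensors V W" if "t \<in> formal_tensors V W" for c and t :: "'a \<times> 'a \<Rightarrow>\<^sub>0 'k"
    using that by (force simp: formal_tensors_def in_keys_iff)
qed (simp add: formal_tensors_def)

lemma pure_in_formal_tensors: "a \<in> V \<Longrightarrow> b \<in> W \<Longrightarrow> pure a b \<in> formal_tensors V W"
  by (simp add: formal_tensors_def pure_def)

context hopf_algebra
begin

lemma antipode_hom: "module_hom (scl E) (scl E) (antipode E)"
  using antipode_linear by (simp add: module_hom_eq_linear)

lemma bilinear_mult: "bilinear_map (scl E) (scl E) (*)"
  by (simp add: bilinear_map_def hom_mult_left hom_mult_right)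

lemma bilinear_mult_antipode: "bilinear_map (scl E) (scl E) (\<lambda>a b. a * antipode E b)"
  by (simp add: bilinear_map_def module_hom_iff module_s distrib_left distrib_right mult_scale_left
      mult_scale_right module_hom.add[OF antipode_hom] module_hom.scale[OF antipode_hom])

lemma sweedler_antipode: "sweedler E (\<lambda>a b. a * antipode E b) a = scl E (counit E a) 1"
  by (simp add: sweedler_def antipode_right)

lemma hopf_subalgebra_spanI:
  assumes one: "1 \<in> span S" and mult: "\<And>a b. a \<in> S \<Longrightarrow> b \<in> S \<Longrightarrow> a * b \<in> span S"
    and comult: "\<And>a. a \<in> S \<Longrightarrow> \<exists>t\<in>formal_tensors (span S) (span S). tensor_eq E (comult E a) t"
    and antipode: "\<And>a. a \<in> S \<Longrightarrow> antipode E a \<in> span S"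
  shows "hopf_subalgebra E (span S)"
  unfolding hopf_subalgebra_def
proof (intro conjI ballI)
  fix a b assume a: "a \<in> span S" and b: "b \<in> span S"
  show "a * b \<in> span S"
    by (rule span_mult_left[OF _ b], rule span_mult_right[OF _ a]) (rule mult)
next
  fix b assume b: "b \<in> span S"
  let ?T = "{a. \<exists>t\<in>formal_tensors (span S) (span S). tensor_eq E (comult E a) t}"
  have "subspace ?T"
  proof (rule subspaceI)
    have "tensor_eq E (comult E 0) 0"
      using comult_scl[of 0 0] by (simp add: formal.scale_zero_left)
    then show "0 \<in> ?T"
      by (auto intro!: bexI[of _ 0] simp: formal.subspace_0[OF formal_tensors_subspace])
  next
    fix a a' assume "a \<in> ?T" "a' \<in> ?T"
    then obtain t t' where "t \<in> formal_tensors (span S) (span S)" "t' \<in> formal_tensors (span S) (span S)"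
      "tensor_eq E (comult E a) t" "tensor_eq E (comult E a') t'" by blast
    then show "a + a' \<in> ?T"
      using formal.subspace_add[OF formal_tensors_subspace]
        tensor_eq_trans[OF comult_add tensor_eq_add] by blast
  next
    fix c a assume "a \<in> ?T"
    then obtain t where "t \<in> formal_tensors (span S) (span S)" "tensor_eq E (comult E a) t"
      by blast
    then show "scl E c a \<in> ?T"
      using formal.subspace_scale[OF formal_tensors_subspace]
        tensor_eq_trans[OF comult_scl tensor_eq_scale] by blast
  qed
  then show "\<exists>t\<in>formal_tensors (span S) (span S). tensor_eq E (comult E b) t"
    using span_minimal[of S ?T] comult b by blast
next
  fix b assume b: "b \<in> span S"
  have "subspace (antipode E -` span S)"
    by (rule module_hom.subspace_vimage[OF antipode_hom]) simp
  then show "antipode E b \<in> span S"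
    using span_minimal[of S "antipode E -` span S"] antipode b by blast
qed (simp_all add: one)

lemma
  assumes "hopf_subalgebra E B"
  shows hopf_subalgebra_subspace: "subspace B"
    and hopf_subalgebra_one: "1 \<in> B"
    and hopf_subalgebra_mult: "\<And>a b. a \<in> B \<Longrightarrow> b \<in> B \<Longrightarrow> a * b \<in> B"
  using assms by (auto simp: hopf_subalgebra_def)

lemma hopf_subalgebra_power: "hopf_subalgebra E B \<Longrightarrow> a \<in> B \<Longrightarrow> a ^ m \<in> B"
  by (induction m) (simp_all add: hopf_subalgebra_one hopf_subalgebra_mult)

lemma hopf_subalgebra_slice:
  assumes "hopf_subalgebra E B" "b \<in> B" "module_hom (scl E) (*) f"
  shows "slice_right f b \<in> B" "slice_left f b \<in> B"
  unfolding slice_right_def slice_left_def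
  using assms(1,2) hopf_subalgebra_subspace[OF assms(1)]
  by (auto intro!: sweedler_mem bilinear_slice assms(3) subspace_scale)

end

context E_alpha_prime
begin

lemma slice_right_coord:
  assumes u: "u \<in> group_elems" and m: "m < p"
  shows "slice_right (coord u m) b = (\<Sum>l<p. scl E (coord u l b) (u * word_sum g x l m))"
proof -
  interpret sl: module_hom "scl E" "scl E" "slice_right (coord u m)"
    by (rule slice_right_hom[OF coord_hom])
  have mono: "slice_right (coord u m) (v * x ^ l) = (if v = u then u * word_sum g x l m else 0)"
    if "v \<in> group_elems" "l < p" for v l
  proof -
    have "slice_right (coord u m) (v * x ^ l)
        = (\<Sum>m'\<le>l. scl E (coord u m (v * x ^ m')) (v * word_sum g x l m'))"
      by (rule slice_right_monomial[OF coord_hom that(1)])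
    also have "\<dots> = (\<Sum>m'\<le>l. if m' = m then (if v = u then u * word_sum g x l m else 0) else 0)"
      by (intro sum.cong refl) (use that u m in \<open>auto simp: coord_monomial\<close>)
    finally show ?thesis by (simp add: word_sum_eq_0)
  qed
  have "slice_right (coord u m) b
      = (\<Sum>v\<in>group_elems. \<Sum>l<p. scl E (coord v l b) (slice_right (coord u m) (v * x ^ l)))"
    by (subst (1) coord_expansion) (simp add: sl.sum sl.scale)
  also have "\<dots> = (\<Sum>v\<in>group_elems. if v = u then \<Sum>l<p. scl E (coord u l b) (u * word_sum g x l m) else 0)"
    by (intro sum.cong refl) (auto simp: mono intro!: sum.neutral)
  finally show ?thesis using u finite_group by simp
qed

lemma leading_coord:
  assumes "coord u l b \<noteq> 0" "l < p"
  obtains l' where "l \<le> l'" "l' < p" "coord u l' b \<noteq> 0"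
    "\<And>m. l' < m \<Longrightarrow> m < p \<Longrightarrow> coord u m b = 0"
proof -
  let ?P = "\<lambda>l'. l' < p \<and> coord u l' b \<noteq> 0"
  define l' where "l' = (GREATEST l'. ?P l')"
  have P: "?P l'" unfolding l'_def
    by (rule GreatestI_nat[of ?P l p]) (use assms in auto)
  have max: "m \<le> l'" if "?P m" for m unfolding l'_def
    by (rule Greatest_le_nat[of ?P m p]) (use that in auto)
  show ?thesis
    by (rule that[of l']) (use P max assms in \<open>auto simp: not_le[symmetric]\<close>)
qed

text \<open>
  For a term of maximal degree \<open>l\<close> at \<open>u\<close>, the only term of the coproduct with right factor \<open>u x\<^sup>l\<close> has
  the left factor \<open>u g\<^sup>l\<close>.
\<close>

lemma leading_group_mem:
  assumes B: "hopf_subalgebra E B" "b \<in> B" and u: "u \<in> group_elems" and l: "l < p"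
    and lead: "coord u l b \<noteq> 0" "\<And>m. l < m \<Longrightarrow> m < p \<Longrightarrow> coord u m b = 0"
  shows "u * g ^ l \<in> B"
proof -
  have "slice_right (coord u l) b
      = (\<Sum>m<p. if m = l then scl E (coord u l b) (u * g ^ l) else 0)"
    unfolding slice_right_coord[OF u l]
  proof (intro sum.cong refl)
    fix m assume "m \<in> {..<p}"
    then show "scl E (coord u m b) (u * word_sum g x m l)
        = (if m = l then scl E (coord u l b) (u * g ^ l) else 0)"
      using lead(2)[of m] by (cases m l rule: linorder_cases) (auto simp: word_sum_diag word_sum_eq_0)
  qed
  also have "\<dots> = scl E (coord u l b) (u * g ^ l)" using l by simp
  finally have "scl E (coord u l b) (u * g ^ l) \<in> B"
    using hopf_subalgebra_slice(1)[OF B coord_hom, of u l] by simp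
  then have "scl E (inverse (coord u l b)) (scl E (coord u l b) (u * g ^ l)) \<in> B"
    by (rule subspace_scale[OF hopf_subalgebra_subspace[OF B(1)]])
  then show ?thesis using lead(1) by simp
qed

text \<open>
  Slicing just below the leading degree produces an element \<open>a v x + c v + d v g\<close> of \<open>B\<close> with \<open>v\<close> in
  the group and \<open>a \<noteq> 0\<close>.  Its right slice at \<open>v x\<close> is \<open>a v g\<close>, its right slice at \<open>v\<close> is \<open>a v x + c v\<close>,
  and the left slice of the latter at \<open>v x\<close> is \<open>a v\<close>.
\<close>

lemma leading_skew_primitive_mem:
  assumes B: "hopf_subalgebra E B" "b \<in> B" and u: "u \<in> group_elems" and l: "Suc l < p"
    and lead: "coord u (Suc l) b \<noteq> 0" "\<And>m. Suc l < m \<Longrightarrow> m < p \<Longrightarrow> coord u m b = 0"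
  shows "g \<in> B" "x \<in> B"
proof -
  note sub = hopf_subalgebra_subspace[OF B(1)]
  have unscale: "a \<in> B" if "scl E c a \<in> B" "c \<noteq> 0" for a c
    using subspace_scale[OF sub that(1), of "inverse c"] that(2) by simp
  define v where "v = u * g ^ l"
  have v: "v \<in> group_elems" and vg: "v * g \<in> group_elems"
    using u g_power_group[of 1] by (simp_all add: v_def group_mult g_power_group)
  have "g \<noteq> 1" using order_of_monomial(2)[of 0 1] p_gt_1 by auto
  then have v_ne: "v * g \<noteq> v" using group_left_cancel[OF v, of g 1] by simp
  define a where "a = coord u (Suc l) b * of_nat (Suc l)"
  have "of_nat (Suc l) \<noteq> (0::'k)"
    using l by (auto simp: of_nat_eq_0_iff_char_dvd simp del: of_nat_Suc dest: dvd_imp_le)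
  then have a: "a \<noteq> 0" using lead(1) by (simp add: a_def)
  obtain e where e: "word_sum g x (Suc l) l
      = scl E (of_nat (Suc l)) (g ^ l * x) + scl E e (g ^ l * (1 - g))"
    by (rule word_sum_subdiag)
  have "slice_right (coord u l) b
      = (\<Sum>m<p. (if m = l then scl E (coord u l b) v else 0)
          + (if m = Suc l then scl E (coord u (Suc l) b) (u * word_sum g x (Suc l) l) else 0))"
    unfolding slice_right_coord[OF u Suc_lessD[OF l]]
  proof (intro sum.cong refl)
    fix m assume "m \<in> {..<p}"
    then show "scl E (coord u m b) (u * word_sum g x m l)
        = (if m = l then scl E (coord u l b) v else 0)
          + (if m = Suc l then scl E (coord u (Suc l) b) (u * word_sum g x (Suc l) l) else 0)"
      using lead(2)[of m]
      by (cases "m < l"; cases "m = l"; cases "m = Suc l")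
         (auto simp: word_sum_diag word_sum_eq_0 v_def simp del: word_sum.simps)
  qed
  also have "\<dots> = scl E (coord u l b) v + scl E (coord u (Suc l) b) (u * word_sum g x (Suc l) l)"
    using l by (simp add: sum.distrib del: word_sum.simps)
  also have "\<dots> = scl E a (v * x) + scl E (coord u l b + coord u (Suc l) b * e) v
      + scl E (- coord u (Suc l) b * e) (v * g)"
    unfolding e by (simp add: v_def a_def algebra_simps mult_scale_right)
  finally obtain c d where "slice_right (coord u l) b
      = scl E a (v * x) + scl E c v + scl E d (v * g)" by blast
  then have b1: "scl E a (v * x) + scl E c v + scl E d (v * g) \<in> B" (is "?b1 \<in> B")
    using hopf_subalgebra_slice(1)[OF B coord_hom, of u l] by simp
  have coord_b1: "coord v m ?b1 = (if m = 1 then a else if m = 0 then c else 0)" if "m < p" for m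
    using that v vg v_ne p_gt_1 coord_monomial[of v m v 1]
    by (auto simp: module_hom.add[OF coord_hom] module_hom.scale[OF coord_hom] coord_group)
  have slice_b1: "slice_right (coord v m) ?b1
      = scl E c (v * word_sum g x 0 m) + scl E a (v * word_sum g x 1 m)" if "m < p" for m
  proof -
    have "slice_right (coord v m) ?b1 = (\<Sum>l<p. (if l = 0 then scl E c (v * word_sum g x 0 m) else 0)
        + (if l = 1 then scl E a (v * word_sum g x 1 m) else 0))"
      unfolding slice_right_coord[OF v that] by (intro sum.cong) (auto simp: coord_b1)
    then show ?thesis using p_gt_1 by (simp add: sum.distrib)
  qed
  have "scl E a (v * g) \<in> B"
    using hopf_subalgebra_slice(1)[OF B(1) b1 coord_hom, of v 1] slice_b1[of 1] p_gt_1 by simp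
  then have vg_mem: "v * g \<in> B" using a unscale by blast
  have b2: "scl E c v + scl E a (v * x) \<in> B" (is "?b2 \<in> B")
    using hopf_subalgebra_slice(1)[OF B(1) b1 coord_hom, of v 0] slice_b1[of 0] p_gt_1 by simp
  have left: "slice_left (coord v 1) (v * x) = v"
  proof -
    have "slice_left (coord v 1) (v * x ^ 1)
        = (\<Sum>m\<le>1. scl E (coord v 1 (v * word_sum g x 1 m)) (v * x ^ m))"
      unfolding slice_left_def
      by (rule sweedler_grouplike_power[OF bilinear_slice(2)[OF coord_hom] grouplike_group[OF v] comult_x])
    then show ?thesis
      using v vg p_gt_1 coord_monomial[of v 1 v 1] by (simp add: coord_group)
  qed
  have left': "slice_left (coord v 1) v = 0"
    unfolding slice_left_def
    using v p_gt_1
    by (simp add: sweedler_grouplike[OF bilinear_slice(2)[OF coord_hom] grouplike_group] coord_group)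
  have "scl E a v \<in> B"
    using hopf_subalgebra_slice(2)[OF B(1) b2 coord_hom, of v 1]
    by (simp add: module_hom.add[OF slice_left_hom[OF coord_hom]]
        module_hom.scale[OF slice_left_hom[OF coord_hom]] left[unfolded One_nat_def] left'[unfolded One_nat_def])
  then have v_mem: "v \<in> B" using a unscale by blast
  then have "scl E a (v * x) \<in> B"
    using subspace_diff[OF sub b2 subspace_scale[OF sub v_mem, of c]] by simp
  then have vx_mem: "v * x \<in> B" using a unscale by blast
  have inv: "v ^ (n * p - 1) \<in> B" by (rule hopf_subalgebra_power[OF B(1) v_mem])
  show "g \<in> B" "x \<in> B"
    using hopf_subalgebra_mult[OF B(1) inv vg_mem] hopf_subalgebra_mult[OF B(1) inv vx_mem]
    by (simp_all only: group_inverse(2)[OF v] mult_1_left flip: mult.assoc)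
qed

text \<open>
  Unless \<open>g\<close> and \<open>x\<close> belong to \<open>B\<close>, all leading degrees of elements of \<open>B\<close> are \<open>0\<close>, and then the
  leading terms themselves are in \<open>B\<close>.
\<close>

lemma hopf_subalgebra_cases:
  assumes B: "hopf_subalgebra E B"
  shows "g \<in> B \<and> x \<in> B \<or> B = span (B \<inter> group_elems)"
proof (cases "g \<in> B \<and> x \<in> B")
  case False
  have "b \<in> span (B \<inter> group_elems)" if b: "b \<in> B" for b
  proof (rule mem_spanI_coord)
    fix u l assume u: "u \<in> group_elems" and l: "l < p" "coord u l b \<noteq> 0"
    obtain l' where l': "l \<le> l'" "l' < p" "coord u l' b \<noteq> 0"
      "\<And>m. l' < m \<Longrightarrow> m < p \<Longrightarrow> coord u m b = 0"
      using leading_coord[OF l(2,1)] by metis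
    have "l' = 0"
      using leading_skew_primitive_mem[OF B b u] l' False by (cases l') auto
    then show "u * x ^ l \<in> span (B \<inter> group_elems)"
      using leading_group_mem[OF B b u l'(2-4)] l'(1) u by (simp add: span_base)
  qed
  moreover have "span (B \<inter> group_elems) \<subseteq> B"
    by (rule span_minimal) (simp_all add: hopf_subalgebra_subspace[OF B])
  ultimately show ?thesis by blast
qed simp

definition radford :: "'e set" where
  "radford = span (radford_monomials g x p)"

lemma radford_subset:
  assumes B: "hopf_subalgebra E B" "g \<in> B" "x \<in> B"
  shows "radford \<subseteq> B"
  unfolding radford_def
  by (rule span_minimal)
     (auto simp: radford_monomials_def hopf_subalgebra_subspace[OF B(1)]
       intro!: hopf_subalgebra_mult[OF B(1)] hopf_subalgebra_power[OF B(1)] B)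

lemma radford_monomial_mem: "g ^ j * x ^ l \<in> radford" if "l < p"
  using that span_base[OF radford_monomialsI[of "j mod p" p l g x]] p_pos
  by (simp add: radford_def g_power_mod)

text \<open>
  An element outside \<open>R\<close> has a nonzero coordinate at some \<open>u = h\<^sup>ig\<^sup>j\<close> with \<open>h\<^sup>i \<noteq> 1\<close>.  Its leading term
  there puts \<open>h\<^sup>i\<close> into \<open>B\<close>, and \<open>h\<close> is a power of \<open>h\<^sup>i\<close> because \<open>n\<close> is prime.
\<close>

lemma hopf_subalgebra_containing_radford:
  assumes B: "hopf_subalgebra E B" "g \<in> B" "x \<in> B"
  shows "B = radford \<or> B = UNIV"
proof (cases "B \<subseteq> radford")
  case True
  then show ?thesis using radford_subset[OF assms] by blast
next
  case False
  then obtain b where b: "b \<in> B" "b \<notin> radford" by blast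
  obtain u l where u: "u \<in> group_elems" and l: "l < p" "coord u l b \<noteq> 0" "u * x ^ l \<notin> radford"
    using mem_spanI_coord[of b "radford_monomials g x p"] b(2) unfolding radford_def by blast
  obtain l' where l': "l' < p" "coord u l' b \<noteq> 0" "\<And>m. l' < m \<Longrightarrow> m < p \<Longrightarrow> coord u m b = 0"
    using leading_coord[OF l(2,1)] by metis
  obtain i j where ij: "u = h ^ i * g ^ j" "i < n"
    using u by (auto simp: group_elems_image)
  have "i \<noteq> 0"
  proof
    assume "i = 0"
    then show False using l(1,3) ij(1) radford_monomial_mem[of l j] by simp
  qed
  then have "\<not> n dvd i" using ij(2) by (auto dest: dvd_imp_le)
  then have "coprime i n"
    using prime_imp_coprime[OF prime_n] coprime_commute by blast
  then obtain e where e: "(h ^ i) ^ e = h"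
    using power_coprime_order[OF h_power_n] by blast
  have "u * g ^ l' \<in> B" by (rule leading_group_mem[OF B(1) b(1) u l'])
  then have "u * g ^ l' * (g ^ (j + l')) ^ (n * p - 1) \<in> B"
    by (rule hopf_subalgebra_mult[OF B(1) _ hopf_subalgebra_power[OF B(1)
        hopf_subalgebra_power[OF B(1,2)]]])
  also have "u * g ^ l' * (g ^ (j + l')) ^ (n * p - 1) = h ^ i"
    using group_inverse(1)[OF g_power_group[of "j + l'"]] by (simp add: ij power_add mult.assoc)
  finally have "h \<in> B" using hopf_subalgebra_power[OF B(1), of "h ^ i" e] e by simp
  then have "B = UNIV"
    using UNIV_subset_closed hopf_subalgebra_subspace hopf_subalgebra_one hopf_subalgebra_mult B
    by metis
  then show ?thesis ..
qed

lemma radford_mult_closed: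
  assumes "a \<in> radford" "b \<in> radford"
  shows "a * b \<in> radford"
  unfolding radford_def
proof (rule span_mult_right[OF _ assms(1)[unfolded radford_def]])
  fix a assume "a \<in> radford_monomials g x p"
  then obtain j l where a: "a = g ^ j * x ^ l" by (auto simp: radford_monomials_def)
  have "x ^ l * b \<in> span (radford_monomials g x p)"
    using assms(2)
    by (induction l) (simp_all add: radford_def radford_span_mult(2) mult.assoc)
  then have "g ^ j * (x ^ l * b) \<in> span (radford_monomials g x p)"
    by (induction j) (simp_all add: radford_span_mult(1) mult.assoc)
  then show "a * b \<in> span (radford_monomials g x p)" by (simp add: a mult.assoc)
qed

lemma g_power_radford: "g ^ j \<in> radford" and x_radford: "x \<in> radford"
  using radford_monomial_mem[of 0 j] radford_monomial_mem[of 1 0] p_gt_1 by simp_all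

lemma word_sum_radford: "word_sum g x l m \<in> radford"
proof (induction l arbitrary: m)
  case 0
  show ?case
    using g_power_radford[of 0] span_zero[of "radford_monomials g x p"]
    by (cases m) (simp_all flip: radford_def)
next
  case (Suc l)
  have pow: "x ^ k \<in> radford" for k
    using g_power_radford[of 0] by (induction k) (simp_all add: radford_mult_closed x_radford)
  show ?case
    using Suc.IH pow[of "Suc l"] g_power_radford[of 1] span_add[of _ "radford_monomials g x p"]
    by (cases m) (simp_all add: radford_mult_closed x_radford del: power_Suc flip: radford_def)
qed

text \<open>
  The axiom for the antipode of \<open>u x\<^sup>l\<close>, with \<open>u\<close> a power of \<open>g\<close>, determines \<open>S(u x\<^sup>l)\<close> recursively
  from the \<open>S(u x\<^sup>m)\<close>, \<open>m < l\<close>, since the coefficient \<open>u g\<^sup>l\<close> of \<open>S(u x\<^sup>l)\<close> is invertible.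
\<close>

lemma antipode_radford: "antipode E (g ^ j * x ^ l) \<in> radford"
proof (induction l rule: less_induct)
  case (less l)
  have u: "g ^ j \<in> group_elems" by (rule g_power_group)
  note sub = subspace_span[of "radford_monomials g x p", folded radford_def]
  let ?W = "\<lambda>m. (g ^ j * word_sum g x l m) * antipode E (g ^ j * x ^ m)"
  have "(\<Sum>m\<le>l. ?W m) = scl E (counit E (g ^ j * x ^ l)) 1"
    using sweedler_antipode[of "g ^ j * x ^ l"]
      sweedler_grouplike_power[OF bilinear_mult_antipode grouplike_group[OF u] comult_x]
    by simp
  then have "g ^ (j + l) * antipode E (g ^ j * x ^ l)
      = scl E (counit E (g ^ j * x ^ l)) 1 - (\<Sum>m<l. ?W m)"
    by (simp add: word_sum_diag power_add algebra_simps lessThan_Suc_atMost[symmetric])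
  also have "\<dots> \<in> radford"
    using less.IH g_power_radford[of 0]
    by (intro subspace_diff[OF sub] subspace_scale[OF sub] subspace_sum[OF sub] radford_mult_closed)
       (auto simp: g_power_radford word_sum_radford)
  finally have mem: "g ^ (j + l) * antipode E (g ^ j * x ^ l) \<in> radford" .
  have "(g ^ (j + l)) ^ (n * p - 1) * (g ^ (j + l) * antipode E (g ^ j * x ^ l)) \<in> radford"
    using radford_mult_closed[OF g_power_radford[of "(j + l) * (n * p - 1)"] mem]
    by (simp only: power_mult)
  then show ?case
    using group_inverse(2)[OF g_power_group[of "j + l"]] by (simp flip: mult.assoc)
qed

lemma hopf_subalgebra_radford: "hopf_subalgebra E radford"
  unfolding radford_def
proof (rule hopf_subalgebra_spanI; (fold radford_def)?)
  show "1 \<in> radford" using g_power_radford[of 0] by simp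
  fix a assume a: "a \<in> radford_monomials g x p"
  then have a_mem: "a \<in> radford" by (simp add: radford_def span_base)
  show "a * b \<in> radford" if "b \<in> radford_monomials g x p" for b
    using a_mem that radford_mult_closed by (simp add: radford_def span_base)
  obtain j l where jl: "a = g ^ j * x ^ l" "l < p"
    using a by (auto simp: radford_monomials_def)
  show "antipode E a \<in> radford" unfolding jl by (rule antipode_radford)
  have "(\<Sum>m\<le>l. pure (g ^ j * word_sum g x l m) (g ^ j * x ^ m)) \<in> formal_tensors radford radford"
    using jl(2)
    by (intro formal.subspace_sum[OF formal_tensors_subspace] pure_in_formal_tensors
        radford_mult_closed g_power_radford word_sum_radford radford_monomial_mem) auto
  then show "\<exists>t\<in>formal_tensors radford radford. tensor_eq E (comult E a) t"
    using comult_grouplike_power[OF grouplike_group[OF g_power_group] comult_x] jl(1) by blast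
qed

lemma radford_generated: "hopf_subalgebra_generated E {g, x} = radford"
  unfolding hopf_subalgebra_generated_def
  using radford_subset hopf_subalgebra_radford g_power_radford[of 1] x_radford by auto

lemma cyclic_eq: "cyclic_group_algebra E u = span (range (\<lambda>i::nat. u ^ i))"
  by (simp add: cyclic_group_algebra_def full_SetCompr_eq)

lemma hopf_subalgebra_cyclic:
  assumes u: "u \<in> group_elems"
  shows "hopf_subalgebra E (cyclic_group_algebra E u)"
  unfolding cyclic_eq
proof (rule hopf_subalgebra_spanI)
  let ?S = "range (\<lambda>i::nat. u ^ i)"
  have mem: "u ^ i \<in> span ?S" for i by (simp add: span_base)
  show "1 \<in> span ?S" using mem[of 0] by simp
  show "a * b \<in> span ?S" if "a \<in> ?S" "b \<in> ?S" for a b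
    using that mem by (auto simp flip: power_add)
  fix a assume "a \<in> ?S"
  then obtain i where i: "a = u ^ i" by blast
  have a: "a \<in> group_elems" using u by (simp add: i group_power_mem)
  show "\<exists>t\<in>formal_tensors (span ?S) (span ?S). tensor_eq E (comult E a) t"
    using grouplike_group[OF a] mem[of i] unfolding grouplike_def i
    by (intro bexI[of _ "pure (u ^ i) (u ^ i)"]) (simp_all add: pure_in_formal_tensors)
  have "a * antipode E a = scl E (counit E a) 1"
    using sweedler_antipode[of a] sweedler_grouplike[OF bilinear_mult_antipode grouplike_group[OF a]]
    by simp
  then have "a ^ (n * p - 1) * (a * antipode E a) = scl E (counit E a) (a ^ (n * p - 1))"
    by (simp add: mult_scale_right)
  then have "antipode E a = scl E (counit E a) (u ^ (i * (n * p - 1)))"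
    using group_inverse(2)[OF a] by (simp add: i power_mult flip: mult.assoc)
  then show "antipode E a \<in> span ?S" using mem by (simp add: span_scale)
qed

lemma cyclic_subset_span_group: "u \<in> group_elems \<Longrightarrow> cyclic_group_algebra E u \<subseteq> span group_elems"
  unfolding cyclic_eq by (rule span_mono) (auto simp: group_power_mem)

lemma cyclic_proper: "u \<in> group_elems \<Longrightarrow> cyclic_group_algebra E u \<noteq> UNIV"
  using cyclic_subset_span_group x_notin_span_group by blast

lemma h_notin_radford: "h \<notin> radford"
proof
  assume h: "h \<in> radford"
  have h_group: "h \<in> group_elems" using h_power_group[of 1] by simp
  have "h \<noteq> g ^ j" if "j < p" for j
    using monomial_eq_iff[of 1 0 0 j] that n_gt_1 p_pos by simp
  then have "radford_monomials g x p \<subseteq> {a. coord h 0 a = 0}"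
    using p_pos h_group by (auto simp: radford_monomials_def coord_monomial g_power_group)
  then have "radford \<subseteq> {a. coord h 0 a = 0}"
    unfolding radford_def
    by (rule span_minimal) (rule module_hom.subspace_kernel[OF coord_hom])
  then show False using h h_group p_pos by (auto simp: coord_group)
qed

lemma radford_proper: "radford \<noteq> UNIV"
  using h_notin_radford by blast

end

section \<open>Exact factorizations\<close>

context hopf_algebra
begin

text \<open>
  Multiplication of formal tensors is linear and vanishes on the null tensors.  So it is constant on
  the classes, and its injectivity on classes can be tested on its kernel.
\<close>

lemma exact_factorization_iff:
  "exact_factorization E B T \<longleftrightarrow> hopf_subalgebra E B \<and> hopf_subalgebra E T \<and>
    (\<forall>e. \<exists>t\<in>formal_tensors B T. lin_ext (scl E) (\<lambda>(b, t). b * t) t = e) \<and>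
    (\<forall>t\<in>formal_tensors B T. lin_ext (scl E) (\<lambda>(b, t). b * t) t = 0 \<longrightarrow> t \<in> tensor_null (scl E) B T)"
proof -
  let ?\<mu> = "lin_ext (scl E) (\<lambda>(b, t). b * t)"
  let ?N = "tensor_null (scl E) B T"
  let ?F = "formal_tensors B T"
  define r where "r = {(t, t'). t \<in> ?F \<and> t' \<in> ?F \<and> t - t' \<in> ?N}"
  note N = subspace_tensor_null[of "scl E" B T] and F = formal_tensors_subspace[of B T]
  interpret \<mu>: module_hom fscale "scl E" ?\<mu> by (rule lin_ext_hom[OF module_s])
  have equiv: "equiv ?F r"
  proof (rule equivI)
    show "r \<subseteq> ?F \<times> ?F" by (auto simp: r_def)
    show "refl_on ?F r" by (auto simp: r_def refl_on_def formal.subspace_0[OF N])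
    show "sym r"
    proof (rule symI)
      fix t t' assume "(t, t') \<in> r"
      then show "(t', t) \<in> r" using formal.subspace_neg[OF N, of "t - t'"] by (simp add: r_def)
    qed
    show "trans r"
    proof (rule transI)
      fix t t' t'' assume "(t, t') \<in> r" "(t', t'') \<in> r"
      then show "(t, t'') \<in> r"
        using formal.subspace_add[OF N, of "t - t'" "t' - t''"] by (simp add: r_def)
    qed
  qed
  have null: "t \<in> ?N \<Longrightarrow> ?\<mu> t = 0" for t
    by (rule lin_ext_tensor_null[OF bilinear_mult])
  have cls: "mult_map E (r `` {t}) = ?\<mu> t" if "t \<in> ?F" for t
  proof -
    have const: "?\<mu> t' = ?\<mu> t" if "(t, t') \<in> r" for t'
      using null[of "t - t'"] that by (simp add: r_def \<mu>.diff)
    have t: "t \<in> r `` {t}" using that by (simp add: r_def formal.subspace_0[OF N])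
    have "?\<mu> ` (r `` {t}) = {?\<mu> t}"
    proof (rule equalityI)
      show "?\<mu> ` (r `` {t}) \<subseteq> {?\<mu> t}"
        by (rule image_subsetI) (simp only: Image_singleton_iff singleton_iff const)
      show "{?\<mu> t} \<subseteq> ?\<mu> ` (r `` {t})" using imageI[OF t, of ?\<mu>] by simp
    qed
    then show ?thesis by (simp add: mult_map_def)
  qed
  have tp: "tensor_product (scl E) B T = ?F // r"
    by (simp add: tensor_product_def r_def)
  have inj: "inj_on (mult_map E) (?F // r) \<longleftrightarrow> (\<forall>t\<in>?F. ?\<mu> t = 0 \<longrightarrow> t \<in> ?N)"
  proof
    assume inj: "inj_on (mult_map E) (?F // r)"
    show "\<forall>t\<in>?F. ?\<mu> t = 0 \<longrightarrow> t \<in> ?N"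
    proof (intro ballI impI)
      fix t assume t: "t \<in> ?F" "?\<mu> t = 0"
      have 0: "0 \<in> ?F" by (rule formal.subspace_0[OF F])
      have "mult_map E (r `` {t}) = mult_map E (r `` {0})"
        by (simp add: cls[OF t(1)] cls[OF 0] t(2) \<mu>.zero)
      then have "r `` {t} = r `` {0}"
        using inj t(1) 0 by (auto dest: inj_onD intro: quotientI)
      then have "(t, 0) \<in> r" using eq_equiv_class[OF _ equiv 0] by blast
      then show "t \<in> ?N" by (simp add: r_def)
    qed
  next
    assume ker: "\<forall>t\<in>?F. ?\<mu> t = 0 \<longrightarrow> t \<in> ?N"
    show "inj_on (mult_map E) (?F // r)"
    proof (rule inj_onI, elim quotientE)
      fix C D t t' assume eq: "mult_map E C = mult_map E D"
        and t: "t \<in> ?F" "C = r `` {t}" and t': "t' \<in> ?F" "D = r `` {t'}"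
      have "?\<mu> (t - t') = 0" using eq t t' cls by (simp add: \<mu>.diff)
      then have "(t, t') \<in> r"
        using ker t(1) t'(1) formal.subspace_diff[OF F] by (auto simp: r_def)
      then show "C = D" using t t' equiv_class_eq[OF equiv] by blast
    qed
  qed
  have surj: "mult_map E ` (?F // r) = UNIV \<longleftrightarrow> (\<forall>e. \<exists>t\<in>?F. ?\<mu> t = e)"
  proof -
    have "mult_map E ` (?F // r) = ?\<mu> ` ?F"
      by (force simp: cls image_iff intro: quotientI elim!: quotientE)
    moreover have "f ` A = UNIV \<longleftrightarrow> (\<forall>e. \<exists>t\<in>A. f t = e)" for f :: "'x \<Rightarrow> 'y" and A
      by (metis UNIV_I UNIV_eq_I image_iff)
    ultimately show ?thesis by simp
  qed
  show ?thesis
    unfolding exact_factorization_def bij_betw_def tp inj surj by blast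
qed

lemma tensor_in_span_pure:
  assumes t: "t \<in> formal_tensors (span (v ` I)) (span (w ` J))"
  shows "t \<in> formal.span (tensor_null (scl E) (span (v ` I)) (span (w ` J))
      \<union> (\<lambda>(i, j). pure (v i) (w j)) ` (I \<times> J))"
    (is "_ \<in> ?Q")
proof (rule formal_induct_pure[of ?Q])
  show "formal.subspace ?Q" by simp
  let ?V = "span (v ` I)" and ?W = "span (w ` J)"
  let ?N = "tensor_null (scl E) ?V ?W"
  have N: "z \<in> ?Q" if "z \<in> ?N" for z using that by (simp add: formal.span_base)
  have close: "y \<in> ?Q" if "z \<in> ?Q" "y - z \<in> ?N" for y z
    using formal.span_add[OF N[OF that(2)] that(1)] by simp
  have 1: "pure a (w j) \<in> ?Q" if "a \<in> ?V" "j \<in> J" for a j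
  proof -
    have wj: "w j \<in> ?W" using that(2) by (simp add: span_base)
    have "?V \<subseteq> {a \<in> ?V. pure a (w j) \<in> ?Q}"
    proof (rule span_minimal)
      show "v ` I \<subseteq> {a \<in> ?V. pure a (w j) \<in> ?Q}"
        using that(2) by (auto intro!: formal.span_base span_base)
      show "subspace {a \<in> ?V. pure a (w j) \<in> ?Q}"
      proof (rule subspaceI)
        show "0 \<in> {a \<in> ?V. pure a (w j) \<in> ?Q}"
          using close[of 0 "pure 0 (w j)"] tensor_null_scale_left[of 0 ?V "w j" ?W "scl E" 0] wj
          by (simp add: span_zero formal.span_zero)
        show "a + a' \<in> {a \<in> ?V. pure a (w j) \<in> ?Q}"
          if "a \<in> {a \<in> ?V. pure a (w j) \<in> ?Q}" "a' \<in> {a \<in> ?V. pure a (w j) \<in> ?Q}" for a a'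
          using that wj close[OF formal.span_add tensor_null_add_left] by (simp add: span_add)
        show "scl E c a \<in> {a \<in> ?V. pure a (w j) \<in> ?Q}"
          if "a \<in> {a \<in> ?V. pure a (w j) \<in> ?Q}" for c a
          using that wj close[OF formal.span_scale tensor_null_scale_left] by (simp add: span_scale)
      qed
    qed
    then show ?thesis using that(1) by blast
  qed
  fix a b assume "(a, b) \<in> Poly_Mapping.keys t"
  then have ab: "a \<in> ?V" "b \<in> ?W" using t by (auto simp: formal_tensors_def)
  have "?W \<subseteq> {b \<in> ?W. pure a b \<in> ?Q}"
  proof (rule span_minimal)
    show "w ` J \<subseteq> {b \<in> ?W. pure a b \<in> ?Q}"
      using 1[OF ab(1)] by (auto intro!: span_base)
    show "subspace {b \<in> ?W. pure a b \<in> ?Q}"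
    proof (rule subspaceI)
      show "0 \<in> {b \<in> ?W. pure a b \<in> ?Q}"
        using close[of 0 "pure a 0"] tensor_null_scale_right[of a ?V 0 ?W "scl E" 0] ab(1)
        by (simp add: span_zero formal.span_zero)
      show "b + b' \<in> {b \<in> ?W. pure a b \<in> ?Q}"
        if "b \<in> {b \<in> ?W. pure a b \<in> ?Q}" "b' \<in> {b \<in> ?W. pure a b \<in> ?Q}" for b b'
        using that ab(1) close[OF formal.span_add tensor_null_add_right] by (simp add: span_add)
      show "scl E c b \<in> {b \<in> ?W. pure a b \<in> ?Q}"
        if "b \<in> {b \<in> ?W. pure a b \<in> ?Q}" for c b
        using that ab(1) close[OF formal.span_scale tensor_null_scale_right] by (simp add: span_scale)
    qed
  qed
  then show "pure a b \<in> ?Q" using ab(2) by blast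
qed

text \<open>
  Modulo null tensors every formal tensor is a combination of the \<open>v\<^sub>i \<otimes> w\<^sub>j\<close>, which multiplication
  sends to the products \<open>v\<^sub>i w\<^sub>j\<close>.
\<close>

lemma exact_factorization_basis:
  assumes hopf: "hopf_subalgebra E (span (v ` I))" "hopf_subalgebra E (span (w ` J))"
    and fin: "finite I" "finite J"
    and indep: "indep_family (scl E) (\<lambda>(i, j). v i * w j) (I \<times> J)"
    and spans: "span ((\<lambda>(i, j). v i * w j) ` (I \<times> J)) = UNIV"
  shows "exact_factorization E (span (v ` I)) (span (w ` J))"
  unfolding exact_factorization_iff
proof (intro conjI hopf allI ballI impI)
  let ?V = "span (v ` I)" and ?W = "span (w ` J)"
  let ?\<mu> = "lin_ext (scl E) (\<lambda>(b, t). b * t)"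
  let ?pure = "\<lambda>(i, j). pure (v i) (w j)"
  interpret \<mu>: module_hom fscale "scl E" ?\<mu> by (rule lin_ext_hom[OF module_s])
  have \<mu>_pure: "?\<mu> (?pure k) = (\<lambda>(i, j). v i * w j) k" for k
    by (cases k) (simp add: lin_ext_pure[OF module_s])
  {
    fix e
    obtain c where e: "e = (\<Sum>k\<in>I \<times> J. scl E (c k) ((\<lambda>(i, j). v i * w j) k))"
      using span_image_family[of e "\<lambda>(i, j). v i * w j" "I \<times> J"] spans fin by auto
    have "(\<Sum>k\<in>I \<times> J. fscale (c k) (?pure k)) \<in> formal_tensors ?V ?W"
      by (intro formal.subspace_sum[OF formal_tensors_subspace]
          formal.subspace_scale[OF formal_tensors_subspace])
         (auto intro!: pure_in_formal_tensors span_base)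
    moreover have "?\<mu> (\<Sum>k\<in>I \<times> J. fscale (c k) (?pure k)) = e"
      by (simp only: \<mu>.sum \<mu>.scale \<mu>_pure e)
    ultimately show "\<exists>t\<in>formal_tensors ?V ?W. ?\<mu> t = e" by blast
  }
  {
    fix t assume t: "t \<in> formal_tensors ?V ?W" "?\<mu> t = 0"
    obtain y z where yz: "t = y + z" "y \<in> formal.span (tensor_null (scl E) ?V ?W)"
      "z \<in> formal.span (?pure ` (I \<times> J))"
      using tensor_in_span_pure[OF t(1)] unfolding formal.span_Un by blast
    have y: "y \<in> tensor_null (scl E) ?V ?W"
      using yz(2) subspace_tensor_null formal.span_eq_iff by blast
    obtain c where z: "z = (\<Sum>k\<in>I \<times> J. fscale (c k) (?pure k))"
      using formal.span_image_family[OF yz(3)] fin by auto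
    have "?\<mu> z = 0"
      using t(2) lin_ext_tensor_null[OF bilinear_mult y] by (simp add: yz(1) \<mu>.add)
    then have "(\<Sum>k\<in>I \<times> J. scl E (c k) ((\<lambda>(i, j). v i * w j) k)) = 0"
      by (simp only: z \<mu>.sum \<mu>.scale \<mu>_pure)
    then have "\<forall>k\<in>I \<times> J. c k = 0"
      using indep unfolding indep_family_def by blast
    then have "z = 0" unfolding z by (intro sum.neutral) auto
    then show "t \<in> tensor_null (scl E) ?V ?W" using y yz(1) by simp
  }
qed

text \<open>
  An element \<open>u\<close> common to both factors and linearly independent of \<open>1\<close> would give the distinct
  tensors \<open>u \<otimes> 1\<close> and \<open>1 \<otimes> u\<close> the same product.
\<close>

lemma exact_factorization_common:
  assumes ex: "exact_factorization E B T" and u: "u \<in> B" "u \<in> T"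
    and f: "module_hom (scl E) (*) f" "f u = 1" "f 1 = 0"
    and f': "module_hom (scl E) (*) f'" "f' 1 = 1"
  shows False
proof -
  let ?t = "pure u 1 - pure 1 u"
  have hopf: "hopf_subalgebra E B" "hopf_subalgebra E T" and
    inj: "\<And>t. t \<in> formal_tensors B T \<Longrightarrow> lin_ext (scl E) (\<lambda>(b, t). b * t) t = 0 \<Longrightarrow> t \<in> tensor_null (scl E) B T"
    using ex by (auto simp: exact_factorization_iff)
  have "?t \<in> formal_tensors B T"
    by (intro formal.subspace_diff[OF formal_tensors_subspace] pure_in_formal_tensors u
        hopf_subalgebra_one hopf)
  moreover have "lin_ext (scl E) (\<lambda>(b, t). b * t) ?t = 0"
    by (simp add: module_hom.diff[OF lin_ext_hom[OF module_s]] lin_ext_pure[OF module_s])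
  ultimately have null: "?t \<in> tensor_null (scl E) B T" by (rule inj)
  note k = f(1)[unfolded module_hom_iff, THEN conjunct2, THEN conjunct1]
  have "bilinear_map (scl E) (*) (\<lambda>a b. f a * f' b)"
    using module_hom.add[OF f(1)] module_hom.scale[OF f(1)] module_hom.add[OF f'(1)]
      module_hom.scale[OF f'(1)]
    by (simp add: bilinear_map_def module_hom_iff module_s k algebra_simps)
  from lin_ext_tensor_null[OF this null] show False
    by (simp add: module_hom.diff[OF lin_ext_hom[OF k]] lin_ext_pure[OF k] f(2,3) f'(2))
qed

lemma exact_factorization_surj:
  assumes ex: "exact_factorization E B T" and S: "subspace S"
    and closed: "\<And>b t. b \<in> B \<Longrightarrow> t \<in> T \<Longrightarrow> b * t \<in> S"
  shows "S = UNIV"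
proof -
  have "e \<in> S" for e
  proof -
    obtain t where "t \<in> formal_tensors B T" "lin_ext (scl E) (\<lambda>(b, t). b * t) t = e"
      using ex by (auto simp: exact_factorization_iff)
    then show ?thesis
      using closed unfolding lin_ext_def formal_tensors_def
      by (auto intro!: subspace_sum[OF S] subspace_scale[OF S])
  qed
  then show ?thesis by blast
qed

end

section \<open>Products of the Radford algebra and cyclic group algebras\<close>

context E_alpha_prime
begin

text \<open>
  There are as many vectors in the family as in the monomial basis, so they are independent as soon
  as they span.
\<close>

lemma indep_family_products:
  assumes "finite K" "card K = n * p * p" "span (f ` K) = UNIV"
  shows "indep_family (scl E) f K"
proof (rule indep_family_of_card[OF monomial_basis(1)])
  show "card K = card (monomial ` exponents)"
    using assms(2) by (simp add: card_image[OF monomial_basis(2)] card_cartesian_product card_group)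
qed (use assms finite_exponents span_monomials in simp_all)

lemma cyclic_eq_finite:
  assumes "w ^ n = 1"
  shows "cyclic_group_algebra E w = span ((\<lambda>i. w ^ i) ` {..<n})"
proof -
  have "w ^ i = w ^ (i mod n)" for i
    by (metis assms mod_mult_div_eq mult_1_right power_add power_mult power_one)
  then have "w ^ i \<in> (\<lambda>i. w ^ i) ` {..<n}" for i
    by (rule image_eqI) (simp add: n_pos)
  then have "range (\<lambda>i. w ^ i) = (\<lambda>i. w ^ i) ` {..<n}" by blast
  then show ?thesis by (simp add: cyclic_eq)
qed

text \<open>
  Multiples of \<open>p - 1\<close> in exponents of \<open>g\<close> stand for negative exponents, here and below.
\<close>

lemma group_elems_factor:
  assumes "u \<in> group_elems"
  obtains i b where "i < n" "b < p" "u = (h * g ^ c) ^ i * g ^ b"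
proof -
  obtain i j where ij: "u = h ^ i * g ^ j" "i < n" using assms by (auto simp: group_elems_image)
  have w: "(h * g ^ c) ^ i = h ^ i * g ^ (c * i)" using group_power_eq[of 1 c i] by simp
  have "g ^ (c * i) * g ^ ((j + c * i * (p - 1)) mod p) = g ^ (j + c * i * p)"
  proof -
    have "c * i + (j + c * i * (p - 1)) = j + c * i * p"
      using p_pos by (cases p) simp_all
    then show ?thesis by (simp only: g_power_mod flip: power_add)
  qed
  also have "\<dots> = g ^ j"
    using g_power_mod[of "j + c * i * p"] g_power_mod[of j] by simp
  finally have "u = (h * g ^ c) ^ i * g ^ ((j + c * i * (p - 1)) mod p)"
    by (simp add: ij(1) w mult.assoc)
  then show ?thesis by (rule that[OF ij(2), rotated]) (simp add: p_pos)
qed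

lemma span_cyclic_radford:
  assumes w: "(h * g ^ c) ^ n = 1"
  shows "span ((\<lambda>(i, k). (h * g ^ c) ^ i * (g ^ fst k * x ^ snd k)) ` ({..<n} \<times> ({..<p} \<times> {..<p})))
    = UNIV"
proof -
  let ?f = "\<lambda>(i, k). (h * g ^ c) ^ i * (g ^ fst k * x ^ snd k)"
  have "monomial ` exponents \<subseteq> ?f ` ({..<n} \<times> ({..<p} \<times> {..<p}))"
  proof (clarsimp simp del: power_mult_distrib)
    fix u l assume u: "u \<in> group_elems" and l: "l < p"
    obtain i b where u: "i < n" "b < p" "u = (h * g ^ c) ^ i * g ^ b"
      using group_elems_factor[OF u] .
    then have "(i, b, l) \<in> {..<n} \<times> ({..<p} \<times> {..<p})" using l by simp
    from imageI[OF this, of ?f] show "u * x ^ l \<in> ?f ` ({..<n} \<times> ({..<p} \<times> {..<p}))"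
      by (simp only: u(3) case_prod_conv fst_conv snd_conv mult.assoc)
  qed
  from span_mono[OF this] show ?thesis
    unfolding span_monomials by (rule subset_antisym[OF subset_UNIV])
qed

text \<open>
  Since \<open>x h = h (x + \<alpha>(1 - g))\<close>, the Radford algebra is normalized by \<open>h\<close>; so the order of the two
  factors can be exchanged.
\<close>

lemma radford_normalized:
  assumes "r \<in> radford"
  obtains r' where "r' \<in> radford" "h ^ i * r = r' * h ^ i"
proof -
  let ?M = "{r. \<exists>r'\<in>radford. h ^ i * r = r' * h ^ i}"
  note sub = subspace_span[of "radford_monomials g x p", folded radford_def]
  have subM: "subspace ?M"
  proof (rule subspaceI)
    show "0 \<in> ?M" using subspace_0[OF sub] by (auto intro!: bexI[of _ 0])
    show "a + b \<in> ?M" if ab: "a \<in> ?M" "b \<in> ?M" for a b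
    proof -
      obtain a' b' where "a' \<in> radford" "h ^ i * a = a' * h ^ i" "b' \<in> radford" "h ^ i * b = b' * h ^ i"
        using ab by blast
      then show ?thesis
        using subspace_add[OF sub] by (auto intro!: bexI[of _ "a' + b'"] simp: distrib_left distrib_right)
    qed
    show "scl E c a \<in> ?M" if a: "a \<in> ?M" for c a
    proof -
      obtain a' where "a' \<in> radford" "h ^ i * a = a' * h ^ i" using a by blast
      then show ?thesis
        using subspace_scale[OF sub]
        by (auto intro!: bexI[of _ "scl E c a'"] simp: mult_scale_left mult_scale_right)
    qed
  qed
  have mult: "a * b \<in> ?M" if ab: "a \<in> ?M" "b \<in> ?M" for a b
  proof -
    obtain a' b' where a': "a' \<in> radford" "h ^ i * a = a' * h ^ i"
      and b': "b' \<in> radford" "h ^ i * b = b' * h ^ i"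
      using ab by blast
    have "h ^ i * (a * b) = (h ^ i * a) * b" by (simp add: mult.assoc)
    also have "\<dots> = a' * (h ^ i * b)" by (simp add: a' mult.assoc)
    also have "\<dots> = (a' * b') * h ^ i" by (simp add: b' mult.assoc)
    finally show ?thesis using radford_mult_closed[OF a'(1) b'(1)] by blast
  qed
  have one: "1 \<in> ?M" using g_power_radford[of 0] by (auto intro!: bexI[of _ 1])
  have g: "g \<in> ?M" using g_power_radford[of 1] power_g_h[of 1 i] by (auto intro!: bexI[of _ g])
  have x: "x \<in> ?M"
  proof -
    have "h ^ i * (1 - g) = (1 - g) * h ^ i"
      using power_g_h[of 1 i] by (simp add: algebra_simps)
    then have "h ^ i * x = (x - scl E (of_nat i * \<alpha>) (1 - g)) * h ^ i"
      using x_h_power[of i] by (simp add: left_diff_distrib mult_scale_left)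
    moreover have "x - scl E (of_nat i * \<alpha>) (1 - g) \<in> radford"
      using g_power_radford[of 0] g_power_radford[of 1]
      by (intro subspace_diff[OF sub] subspace_scale[OF sub] x_radford) simp_all
    ultimately show ?thesis by blast
  qed
  have pow: "a ^ m \<in> ?M" if "a \<in> ?M" for a m
    using that by (induction m) (use one mult in simp_all)
  have "radford_monomials g x p \<subseteq> ?M"
  proof
    fix b assume "b \<in> radford_monomials g x p"
    then obtain j l where b: "b = g ^ j * x ^ l" by (auto simp: radford_monomials_def)
    show "b \<in> ?M" unfolding b by (rule mult[OF pow[OF g] pow[OF x]])
  qed
  then have "radford \<subseteq> ?M" using span_minimal[OF _ subM] by (simp only: radford_def)
  then show ?thesis using assms that by blast
qed

lemma span_radford_cyclic:
  assumes w: "(h * g ^ c) ^ n = 1"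
  shows "span ((\<lambda>(k, i). (g ^ fst k * x ^ snd k) * (h * g ^ c) ^ i) ` (({..<p} \<times> {..<p}) \<times> {..<n}))
    = UNIV"
proof -
  let ?f = "\<lambda>(k, i). (g ^ fst k * x ^ snd k) * (h * g ^ c) ^ i"
  let ?S = "span (?f ` (({..<p} \<times> {..<p}) \<times> {..<n}))"
  have prod: "r * (h * g ^ c) ^ i \<in> ?S" if r: "r \<in> radford" and i: "i < n" for r i
  proof (rule span_mult_right[OF _ r[unfolded radford_def]])
    fix b assume "b \<in> radford_monomials g x p"
    then obtain j l where b: "b = g ^ j * x ^ l" "j < p" "l < p" by (auto simp: radford_monomials_def)
    then have "((j, l), i) \<in> ({..<p} \<times> {..<p}) \<times> {..<n}" using i by simp
    from imageI[OF this, of ?f] show "b * (h * g ^ c) ^ i \<in> ?S"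
      by (simp only: b(1) case_prod_conv fst_conv snd_conv span_base)
  qed
  have "monomial ` exponents \<subseteq> ?S"
  proof
    fix b assume "b \<in> monomial ` exponents"
    then obtain i j l where b: "b = h ^ i * (g ^ j * x ^ l)" "i < n" "l < p"
      by (auto simp: group_elems_image mult.assoc)
    obtain r where r: "r \<in> radford" "b = r * h ^ i"
      using radford_normalized[OF radford_monomial_mem[OF b(3), of j]] b(1) by metis
    have "h ^ i = g ^ (c * i * (p - 1)) * (h * g ^ c) ^ i"
    proof -
      have "g ^ (c * i * (p - 1)) * (h * g ^ c) ^ i = h ^ i * g ^ (c * i * (p - 1) + c * i)"
        using group_power_eq[of 1 c i] group_mult_eq[of 0 "c * i * (p - 1)" i "c * i"] by simp
      also have "c * i * (p - 1) + c * i = c * i * p" using p_pos by (cases p) simp_all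
      finally show ?thesis using g_power_mod[of "c * i * p"] by simp
    qed
    then have "b = (r * g ^ (c * i * (p - 1))) * (h * g ^ c) ^ i"
      using r(2) by (simp only: mult.assoc)
    then show "b \<in> ?S"
      using prod[OF radford_mult_closed[OF r(1) g_power_radford] b(2)] by simp
  qed
  then have "span (monomial ` exponents) \<subseteq> ?S" by (rule span_minimal) (rule subspace_span)
  then show ?thesis unfolding span_monomials by (rule subset_antisym[OF subset_UNIV])
qed

lemma radford_eq_span:
  "radford = span ((\<lambda>k. g ^ fst k * x ^ snd k) ` ({..<p} \<times> {..<p}))"
  by (simp add: radford_def radford_monomials_def case_prod_beta)

lemma exact_factorization_radford_cyclic:
  assumes w: "(h * g ^ c) ^ n = 1"
  shows "nontrivial_exact_factorization E radford (cyclic_group_algebra E (h * g ^ c))"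
    and "nontrivial_exact_factorization E (cyclic_group_algebra E (h * g ^ c)) radford"
proof -
  have wG: "h * g ^ c \<in> group_elems" using group_elemsI[of 1 c] by simp
  note hopf = hopf_subalgebra_radford[unfolded radford_eq_span]
    hopf_subalgebra_cyclic[OF wG, unfolded cyclic_eq_finite[OF w]]
  have "exact_factorization E radford (cyclic_group_algebra E (h * g ^ c))"
    unfolding radford_eq_span cyclic_eq_finite[OF w]
    using span_radford_cyclic[OF w]
    by (intro exact_factorization_basis hopf indep_family_products)
       (simp_all add: card_cartesian_product mult.commute mult.left_commute)
  moreover have "exact_factorization E (cyclic_group_algebra E (h * g ^ c)) radford"
    unfolding radford_eq_span cyclic_eq_finite[OF w]
    using span_cyclic_radford[OF w]
    by (intro exact_factorization_basis hopf indep_family_products)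
       (simp_all add: card_cartesian_product)
  ultimately show "nontrivial_exact_factorization E radford (cyclic_group_algebra E (h * g ^ c))"
    "nontrivial_exact_factorization E (cyclic_group_algebra E (h * g ^ c)) radford"
    by (simp_all add: nontrivial_exact_factorization_def radford_proper cyclic_proper[OF wG])
qed

section \<open>Classification of the exact factorizations\<close>

text \<open>
  These conditions are symmetric in the two factors, in contrast to the definition of an exact
  factorization; they suffice for the classification.
\<close>

lemma nontrivial_exact_factorizationD:
  assumes "nontrivial_exact_factorization E B T"
  shows "B \<inter> T \<inter> group_elems \<subseteq> {1}" "g \<in> B \<and> x \<in> B \<or> g \<in> T \<and> x \<in> T"
    "B \<noteq> span {1}" "T \<noteq> span {1}"
proof -
  have ex: "exact_factorization E B T" and proper: "B \<noteq> UNIV" "T \<noteq> UNIV"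
    using assms by (auto simp: nontrivial_exact_factorization_def)
  have hopf: "hopf_subalgebra E B" "hopf_subalgebra E T"
    using ex by (auto simp: exact_factorization_def)
  have one: "1 \<in> group_elems" using g_power_group[of 0] by simp
  show "B \<inter> T \<inter> group_elems \<subseteq> {1}"
  proof (rule subsetI, rule ccontr)
    fix u assume u: "u \<in> B \<inter> T \<inter> group_elems" and "u \<notin> {1}"
    then show False
      using exact_factorization_common[OF ex _ _ coord_hom[of u 0] _ _ coord_hom[of 1 0], of u] one p_pos
      by (simp add: coord_group)
  qed
  show "g \<in> B \<and> x \<in> B \<or> g \<in> T \<and> x \<in> T"
  proof (rule ccontr)
    assume "\<not> ?thesis"
    moreover have "g \<in> A \<and> x \<in> A \<or> A \<subseteq> span group_elems" if "hopf_subalgebra E A" for A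
      using hopf_subalgebra_cases[OF that] by (metis Int_lower2 span_mono)
    ultimately have BT: "B \<subseteq> span group_elems" "T \<subseteq> span group_elems"
      using hopf by blast+
    have "b * t \<in> span group_elems" if "b \<in> B" "t \<in> T" for b t
    proof (rule span_mult_left[of group_elems])
      show "t \<in> span group_elems" using that BT by blast
      fix v assume v: "v \<in> group_elems"
      show "b * v \<in> span group_elems"
      proof (rule span_mult_right[of group_elems])
        show "b \<in> span group_elems" using that BT by blast
      qed (simp add: span_base group_mult v)
    qed
    then have "span group_elems = UNIV" by (rule exact_factorization_surj[OF ex subspace_span])
    then show False using x_notin_span_group by blast
  qed
  have "B = UNIV" if T: "T = span {1}"
  proof (rule exact_factorization_surj[OF ex hopf_subalgebra_subspace[OF hopf(1)]])
    fix b t assume "b \<in> B" "t \<in> T"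
    then show "b * t \<in> B"
      using hopf_subalgebra_subspace[OF hopf(1)]
      by (auto simp: T span_singleton mult_scale_right subspace_scale)
  qed
  then show "T \<noteq> span {1}" using proper(1) by blast
  have "T = UNIV" if B: "B = span {1}"
  proof (rule exact_factorization_surj[OF ex hopf_subalgebra_subspace[OF hopf(2)]])
    fix b t assume "b \<in> B" "t \<in> T"
    then show "b * t \<in> T"
      using hopf_subalgebra_subspace[OF hopf(2)]
      by (auto simp: B span_singleton mult_scale_left subspace_scale)
  qed
  then show "B \<noteq> span {1}" using proper(2) by blast
qed

text \<open>
  The factor that does not contain \<open>R\<close> is spanned by a subgroup that meets the group generated by
  \<open>g\<close> trivially; as \<open>n\<close> is prime, this is a complement, generated by some \<open>h g\<^sup>c\<close>.
\<close>

lemma complement_cyclic: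
  assumes T: "hopf_subalgebra E T" and meet: "\<And>j. g ^ j \<in> T \<Longrightarrow> g ^ j = 1"
    and nontriv: "T \<noteq> span {1}"
  obtains c where "c < p" "(h * g ^ c) ^ n = 1" "T = cyclic_group_algebra E (h * g ^ c)"
proof -
  note mult = hopf_subalgebra_mult[OF T] and power = hopf_subalgebra_power[OF T]
  have "g \<noteq> 1" using order_of_monomial(2)[of 0 1] p_gt_1 by auto
  then have span: "T = span (T \<inter> group_elems)"
    using hopf_subalgebra_cases[OF T] meet[of 1] by auto
  have one: "1 \<in> T \<inter> group_elems" using hopf_subalgebra_one[OF T] g_power_group[of 0] by simp
  have "\<not> T \<inter> group_elems \<subseteq> {1}"
  proof
    assume "T \<inter> group_elems \<subseteq> {1}"
    then have "T \<inter> group_elems = {1}" using one by blast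
    then show False using span nontriv by simp
  qed
  then obtain u where u: "u \<in> T" "u \<in> group_elems" "u \<noteq> 1" by blast
  obtain i j where ij: "u = h ^ i * g ^ j" "i < n" using u(2) by (auto simp: group_elems_image)
  have "i \<noteq> 0"
  proof
    assume "i = 0"
    then show False using meet[of j] u(1,3) ij(1) by simp
  qed
  then have "\<not> n dvd i" using ij(2) by (auto dest: dvd_imp_le)
  then have "coprime i n" using prime_imp_coprime[OF prime_n] coprime_commute by blast
  then obtain e where e: "(h ^ i) ^ e = h" using power_coprime_order[OF h_power_n] by blast
  define c where "c = (j * e) mod p"
  let ?w = "h * g ^ c"
  have w: "?w \<in> T"
    using power[OF u(1), of e] e by (simp add: ij(1) group_power_eq c_def g_power_mod power_mult)
  have w_group: "?w \<in> group_elems" using group_elemsI[of 1 c] by simp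
  have w_power: "?w ^ m = h ^ m * g ^ (c * m)" for m using group_power_eq[of 1 c m] by simp
  have wn: "?w ^ n = 1"
    using meet[of "c * n"] power[OF w, of n] by (simp add: w_power h_power_n)
  have "s \<in> range (\<lambda>i. ?w ^ i)" if s: "s \<in> T \<inter> group_elems" for s
  proof -
    obtain i b where ib: "i < n" "b < p" "s = ?w ^ i * g ^ b"
      using group_elems_factor[of s c] s by auto
    have wi: "?w ^ i \<in> group_elems" using w_group by (rule group_power_mem)
    have "(?w ^ i) ^ (n * p - 1) * s = g ^ b"
      using group_inverse(2)[OF wi] by (simp only: ib(3) mult_1_left flip: mult.assoc)
    then have "g ^ b \<in> T" using mult[OF power[OF power[OF w]], of s] s by (metis IntD1)
    then have "s = ?w ^ i" using meet[of b] ib(3) by simp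
    then show ?thesis by blast
  qed
  moreover have "range (\<lambda>i. ?w ^ i) \<subseteq> T \<inter> group_elems"
    using power[OF w] group_power_mem[OF w_group] by blast
  ultimately have "T \<inter> group_elems = range (\<lambda>i. ?w ^ i)" by blast
  then have "T = cyclic_group_algebra E ?w" using span by (simp add: cyclic_eq)
  moreover have "c < p" using p_pos by (simp add: c_def)
  ultimately show ?thesis using that wn by blast
qed

lemma factorization_containing_radford:
  assumes hopf: "hopf_subalgebra E B" "hopf_subalgebra E T" and R: "g \<in> B" "x \<in> B"
    and proper: "B \<noteq> UNIV" and meet: "B \<inter> T \<inter> group_elems \<subseteq> {1}" and T: "T \<noteq> span {1}"
  obtains c where "c < p" "(h * g ^ c) ^ n = 1" "B = radford" "T = cyclic_group_algebra E (h * g ^ c)"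
proof -
  have "B = radford" using hopf_subalgebra_containing_radford[OF hopf(1) R] proper by blast
  moreover have "g ^ j = 1" if "g ^ j \<in> T" for j
    using meet that hopf_subalgebra_power[OF hopf(1) R(1), of j] g_power_group[of j] by blast
  ultimately show ?thesis
    using complement_cyclic[OF hopf(2) _ T] that by blast
qed

text \<open>
  The condition \<open>(h g\<^sup>c)\<^sup>n = 1\<close> unites the two cases: if \<open>n = p\<close> it holds for all \<open>c\<close>, and if \<open>n \<noteq> p\<close>
  only \<open>c = 0\<close> satisfies it in the range \<open>c < p\<close>.
\<close>

theorem nontrivial_exact_factorization_iff:
  "nontrivial_exact_factorization E B T \<longleftrightarrow>
    (\<exists>c<p. (h * g ^ c) ^ n = 1 \<and>
      (B = radford \<and> T = cyclic_group_algebra E (h * g ^ c) \<or>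
       B = cyclic_group_algebra E (h * g ^ c) \<and> T = radford))"
proof
  assume ex: "nontrivial_exact_factorization E B T"
  then have hopf: "hopf_subalgebra E B" "hopf_subalgebra E T" and proper: "B \<noteq> UNIV" "T \<noteq> UNIV"
    by (auto simp: nontrivial_exact_factorization_def exact_factorization_def)
  note D = nontrivial_exact_factorizationD[OF ex]
  from D(2) show "\<exists>c<p. (h * g ^ c) ^ n = 1 \<and>
      (B = radford \<and> T = cyclic_group_algebra E (h * g ^ c) \<or>
       B = cyclic_group_algebra E (h * g ^ c) \<and> T = radford)"
  proof
    assume "g \<in> B \<and> x \<in> B"
    then show ?thesis
      using factorization_containing_radford[OF hopf _ _ proper(1) D(1,4)] by metis
  next
    assume "g \<in> T \<and> x \<in> T"
    moreover have "T \<inter> B \<inter> group_elems \<subseteq> {1}" using D(1) by blast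
    ultimately show ?thesis
      using factorization_containing_radford[OF hopf(2,1) _ _ proper(2) _ D(3)] by metis
  qed
qed (use exact_factorization_radford_cyclic in blast)

lemma complement_order:
  assumes "c < p"
  shows "(h * g ^ c) ^ n = 1 \<longleftrightarrow> c = 0 \<or> n = p"
proof -
  have eq: "(h * g ^ c) ^ n = g ^ (c * n)" using group_power_eq[of 1 c n] by (simp add: h_power_n)
  have "g ^ m = 1" if "p dvd m" for m
    using that g_power_p by (auto simp: power_mult elim!: dvdE)
  then have "(h * g ^ c) ^ n = 1 \<longleftrightarrow> p dvd c * n"
    using order_of_monomial(2)[of 0 "c * n"] unfolding eq by auto
  also have "\<dots> \<longleftrightarrow> p dvd c \<or> p dvd n" using prime_p by (simp add: prime_dvd_mult_iff)
  also have "\<dots> \<longleftrightarrow> c = 0 \<or> n = p"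
    using assms prime_p prime_n primes_dvd_imp_eq[of p n] by (auto dest: dvd_imp_le)
  finally show ?thesis .
qed

lemma card_g_powers: "card {g ^ j |j::nat. True} = p"
proof -
  have "{g ^ j |j::nat. True} = (\<lambda>j. g ^ j) ` {..<p}"
  proof -
    have "g ^ j \<in> (\<lambda>j. g ^ j) ` {..<p}" for j
      by (rule image_eqI[of _ _ "j mod p"]) (simp_all add: g_power_mod p_pos)
    then show ?thesis by blast
  qed
  moreover have "inj_on (\<lambda>j. g ^ j) {..<p}"
    using monomial_eq_iff[of 0 0] n_pos by (auto simp: inj_on_def)
  ultimately show ?thesis by (simp add: card_image)
qed

section \<open>The presentation of the Radford algebra\<close>

text \<open>
  The defining relations of \<open>R\<close> bring every noncommutative polynomial in \<open>g\<close> and \<open>x\<close> to a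
  combination of the monomials \<open>g\<^sup>jx\<^sup>l\<close>, and these are linearly independent in \<open>E\<close>; so there are no
  further relations.
\<close>

lemma radford_presentation: "presented_by E radford (radford_assign g x) radford_relators"
proof -
  let ?ev = "alg_eval (scl E) (radford_assign g x)"
  let ?I = "two_sided_ideal radford_relators :: (radford_gen free_word \<Rightarrow>\<^sub>0 'k) set"
  let ?G = "gen Rg :: radford_gen free_word \<Rightarrow>\<^sub>0 'k" and ?X = "gen Rx :: radford_gen free_word \<Rightarrow>\<^sub>0 'k"
  let ?M = "free.radford_monomials ?G ?X p"
  have rel: "?G ^ p - 1 \<in> ?I" "?X ^ p - ?X \<in> ?I" "(?G * ?X - ?X * ?G) - ?G * (1 - ?G) \<in> ?I"
    by (rule two_sided_ideal_base, simp add: radford_relators_def Let_def)+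
  have "?ev t \<in> radford" for t
    unfolding radford_def
  proof (rule alg_eval_mem)
    show "1 \<in> span (radford_monomials g x p)" using g_power_radford[of 0] by (simp add: radford_def)
    show "radford_assign g x i * a \<in> span (radford_monomials g x p)"
      if "a \<in> span (radford_monomials g x p)" for i a
      using that radford_span_mult by (cases i) auto
  qed simp
  moreover have "r \<in> range ?ev" if "r \<in> radford" for r
  proof -
    have "subspace (range ?ev)"
      using module_hom.subspace_image[OF alg_eval_hom formal.subspace_UNIV] .
    moreover have "radford_monomials g x p \<subseteq> range ?ev"
    proof -
      have "g ^ j * x ^ l = ?ev (?G ^ j * ?X ^ l)" for j l by (simp add: alg_eval_simps)
      then show ?thesis by (auto simp: radford_monomials_def)
    qed
    ultimately show ?thesis using that span_minimal unfolding radford_def by blast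
  qed
  ultimately have range: "range ?ev = radford" by blast
  have ideal: "?ev t = 0" if "t \<in> ?I" for t
  proof (rule alg_eval_ideal_zero[OF _ that])
    fix r :: "radford_gen free_word \<Rightarrow>\<^sub>0 'k" assume "r \<in> radford_relators"
    then show "?ev r = 0"
      by (auto simp: radford_relators_def Let_def alg_eval_simps g_power_p x_power_p g_x)
  qed
  have "t \<in> ?I" if t: "?ev t = 0" for t
  proof -
    have word: "Poly_Mapping.single (Word w) 1 \<in> formal.span (?M \<union> ?I)" for w
    proof (induction w)
      case Nil
      have "?G ^ 0 * ?X ^ 0 \<in> ?M" using p_pos by (intro free.radford_monomialsI)
      then show ?case by (simp add: formal.span_base flip: zero_free_word_def)
    next
      case (Cons i w)
      have "Poly_Mapping.single (Word (i # w)) 1 = gen i * Poly_Mapping.single (Word w) (1::'k)"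
        by (simp add: gen_def mult_single plus_free_word_def)
      then show ?case
        using free.radford_span_closed[OF subspace_two_sided_ideal two_sided_ideal_mult_left
            two_sided_ideal_mult_right rel p_gt_1 Cons.IH]
        by (cases i) simp_all
    qed
    have "t \<in> formal.span (?M \<union> ?I)"
    proof -
      have "{Poly_Mapping.single a 1 |a. a \<in> Poly_Mapping.keys t} \<subseteq> formal.span (?M \<union> ?I)"
      proof clarify
        fix a
        show "Poly_Mapping.single a 1 \<in> formal.span (?M \<union> ?I)" using word by (cases a) simp
      qed
      from formal.span_minimal[OF this] formal_in_span_pure[of t] show ?thesis by auto
    qed
    then obtain m i where mi: "t = m + i" "m \<in> formal.span ?M" "i \<in> formal.span ?I"
      unfolding formal.span_Un by blast
    have i: "i \<in> ?I" using mi(3) subspace_two_sided_ideal formal.span_eq_iff by blast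
    obtain c where m: "m = (\<Sum>k\<in>{..<p} \<times> {..<p}. fscale (c k) ((\<lambda>(j, l). ?G ^ j * ?X ^ l) k))"
      using formal.span_image_family[of m "\<lambda>(j, l). ?G ^ j * ?X ^ l" "{..<p} \<times> {..<p}"] mi(2)
      by (auto simp: free.radford_monomials_def)
    have "?ev m = 0" using t ideal[OF i] by (simp add: mi(1) alg_eval_add)
    then have "(\<Sum>k\<in>{..<p} \<times> {..<p}. scl E (c k) ((\<lambda>(j, l). g ^ j * x ^ l) k)) = 0"
      by (simp add: m alg_eval_sum alg_eval_scale case_prod_beta alg_eval_mult alg_eval_power alg_eval_gen)
    moreover have "indep_family (scl E) (\<lambda>(j, l). g ^ j * x ^ l) ({..<p} \<times> {..<p})"
    proof (rule independent_indep_family)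
      show "independent ((\<lambda>(j, l). g ^ j * x ^ l) ` ({..<p} \<times> {..<p}))"
        by (rule independent_mono[OF monomial_basis(1)])
           (force simp: g_power_group image_iff)
      show "inj_on (\<lambda>(j, l). g ^ j * x ^ l) ({..<p} \<times> {..<p})"
      proof (rule inj_onI, clarsimp)
        fix j l j' l' assume *: "j < p" "l < p" "j' < p" "l' < p" "g ^ j * x ^ l = g ^ j' * x ^ l'"
        then have "g ^ j = g ^ j' \<and> l = l'"
          using inj_onD[OF monomial_basis(2), of "(g ^ j, l)" "(g ^ j', l')"] by (simp add: g_power_group)
        then show "j = j' \<and> l = l'" using monomial_eq_iff[of 0 0 j j'] * n_pos by simp
      qed
    qed simp
    ultimately have "\<forall>k\<in>{..<p} \<times> {..<p}. c k = 0" unfolding indep_family_def by blast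
    then have "m = 0" unfolding m by (intro sum.neutral) auto
    then show ?thesis using i mi(1) by simp
  qed
  then show ?thesis
    using range ideal unfolding presented_by_def eval_free_eq_alg_eval by auto
qed

lemma is_radford_algebra_radford: "is_radford_algebra E radford g x"
  by (simp add: is_radford_algebra_def hopf_subalgebra_radford radford_presentation comult_g comult_x)

end

section \<open>Exact factorizations for prime order\<close>

theorem corollary5p10:
  fixes E :: "('k::alg_closed_field, 'e::ring_1) hopf"
    and p n :: nat and \<alpha> :: 'k and g h x :: 'e and R :: "'e set"
  assumes "CHAR('k) = p" and "p > 0" and "prime n"
    and "E_alpha E n \<alpha> g h x"
    and "R = hopf_subalgebra_generated E {g, x}"
  shows
    "(n \<noteq> p \<longrightarrow> \<alpha> = 0 \<and>
        (\<forall>B T. nontrivial_exact_factorization E B T \<longleftrightarrow>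
           (B = R \<and> T = cyclic_group_algebra E h) \<or>
           (B = cyclic_group_algebra E h \<and> T = R))) \<and>
     (n = p \<longrightarrow>
        (\<forall>B T. nontrivial_exact_factorization E B T \<longleftrightarrow>
           (\<exists>c<p. (B = R \<and> T = cyclic_group_algebra E (h * g ^ c)) \<or>
                  (B = cyclic_group_algebra E (h * g ^ c) \<and> T = R)))) \<and>
     is_radford_algebra E R g x \<and>
     card {g ^ j |j::nat. True} = p \<and>
     (\<forall>j::nat. g ^ j * x - x * g ^ j = scl E (of_nat j) (g ^ j * (1 - g)))"
proof -
  interpret E_alpha_prime E n \<alpha> g h x p
    using assms(1-4) by (simp add: E_alpha_prime_def E_alpha_prime_axioms_def)
  have R: "R = radford" using assms(5) radford_generated by simp
  show ?thesis
  proof (intro conjI impI allI)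
    assume ne: "n \<noteq> p"
    show "\<alpha> = 0"
      using parameter primes_dvd_imp_eq[OF prime_p prime_n] ne by auto
    show "nontrivial_exact_factorization E B T \<longleftrightarrow>
        (B = R \<and> T = cyclic_group_algebra E h) \<or> (B = cyclic_group_algebra E h \<and> T = R)" for B T
    proof -
      have "c < p \<and> (h * g ^ c) ^ n = 1 \<longleftrightarrow> c = 0" for c
        using complement_order[of c] ne p_pos by auto
      then show ?thesis
        unfolding nontrivial_exact_factorization_iff R by (metis mult_1_right power_0)
    qed
  next
    fix B T assume "n = p"
    then show "nontrivial_exact_factorization E B T \<longleftrightarrow>
           (\<exists>c<p. (B = R \<and> T = cyclic_group_algebra E (h * g ^ c)) \<or>
                  (B = cyclic_group_algebra E (h * g ^ c) \<and> T = R))"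
      unfolding nontrivial_exact_factorization_iff R using complement_order by blast
  next
    show "is_radford_algebra E R g x" unfolding R by (rule is_radford_algebra_radford)
    show "card {g ^ j |j::nat. True} = p" by (rule card_g_powers)
    show "g ^ j * x - x * g ^ j = scl E (of_nat j) (g ^ j * (1 - g))" for j by (rule g_power_x)
  qed
qed

end
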